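(* For all integers $r \geq 2$ and $1 \leq t \leq r-1$, the graph $D_{r,t}$ (constructed in the context) is a fullerene graph on $12r^2$ vertices of diameter at most $4r$. In particular, writing $n = 12r^2$ for the number of vertices of $D_{r,t}$, one has $\operatorname{diam}(D_{r,t}) \leq \sqrt{4n/3}$. Consequently, for every $r\ge 2$ and every $1\le t\le r-1$ there exists a fullerene graph on $12r^2$ vertices of diameter at most $4r$.
   Context: A fullerene graph is a (finite) cubic bridgeless plane graph all of whose faces, including the outer face, are pentagonal or hexagonal, i.e. bounded by cycles of length $5$ or $6$ (in particular it is connected). The diameter $\operatorname{diam}(G)$ of a graph $G$ is the maximum distance between two vertices of $G$. Construction of $D_{r,t}$. Let $T$ be the infinite $6$-regular planar triangulation (the triangular lattice). For a vertex $u \in V(T)$ let $T_r(u)$ be the subgraph of $T$ induced by all vertices at distance at most $r$ from $u$, with its inherited plane embedding (a triangulated hexagon of side length $r$). Its outer cycle has $6r$ vertices, exactly six of which have degree $3$ in $T_r(u)$ (the corners), all the others having degree $4$. Label the outer cycle in cyclic order as $u_1, u_2, \ldots, u_{6r}$ so that the corners are $u_{kr}$ for $1 \leq k \leq 6$. Now let $r \geq 2$ and $1 \leq t \leq r-1$ be integers. Take two disjoint copies $T_r(a)$ and $T_r(b)$ of this graph, with centres $a$ and $b$, and with outer cycles $u_1,\ldots,u_{6r}$ and $v_1,\ldots,v_{6r}$ respectively, each labelled in cyclic order so that the six corners (the vertices of degree $3$ in the respective copy) are exactly the vertices whose index is a multiple of $r$ (so the corners are $u_{kr}$ and $v_{kr}$,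 $1\le k\le 6$). The graph $D_{r,t}^*$ is obtained from the disjoint union of $T_r(a)$ and $T_r(b)$ by identifying $u_i$ with $v_{i+t}$ for all $1 \leq i \leq 6r$ (indices modulo $6r$); the outer cycles, including their edges, are thereby identified, so that the two triangulated hexagons are glued along their boundaries to form a triangulation of the sphere whose faces are exactly the triangular inner faces of the two copies. The graph $D_{r,t}$ is the planar dual of the planar triangulation $D_{r,t}^*$. *)

theory Defs
  imports
    Complex_Main
    "HOL-Library.Product_Plus"
    "HOL-Combinatorics.Orbits"
    "Graph_Theory.Graph_Theory"
begin

section \<open>Distance, diameter, bridges\<close>

text \<open>
  Undirected graphs are symmetric digraphs: an edge is a pair of mutually reverse arcs.
  Distances are extended reals, so the diameter of a disconnected graph is \<open>\<infinity>\<close>.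
\<close>

definition gdist :: "('a, 'b) pre_digraph \<Rightarrow> 'a \<Rightarrow> 'a \<Rightarrow> ereal" where
  "gdist G u v = wf_digraph.\<mu> G (\<lambda>_. 1) u v"

definition diam :: "('a, 'b) pre_digraph \<Rightarrow> ereal" where
  "diam G = (SUP u \<in> verts G. SUP v \<in> verts G. gdist G u v)"

definition del_edge :: "('a, 'b) pre_digraph \<Rightarrow> ('b \<Rightarrow> 'b) \<Rightarrow> 'b \<Rightarrow> ('a, 'b) pre_digraph" where
  "del_edge G \<rho> a = pre_digraph.del_arc (pre_digraph.del_arc G a) (\<rho> a)"

definition bridgeless :: "('a, 'b) pre_digraph \<Rightarrow> ('b \<Rightarrow> 'b) \<Rightarrow> bool" where
  "bridgeless G \<rho> \<longleftrightarrow> (\<forall>a \<in> arcs G. tail G a \<rightarrow>\<^sup>*\<^bsub>del_edge G \<rho> a\<^esub> head G a)"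


section \<open>Plane graphs\<close>

text \<open>
  A plane graph is represented by its combinatorial map: \<open>arc_rev\<close> sends an arc to its reverse,
  and \<open>arc_succ\<close> sends an arc to the next arc with the same tail in the cyclic order around that
  tail.  The faces (including the outer one) are the orbits of \<open>arc_succ \<circ> arc_rev\<close>; such an orbit
  consists of the arcs traversed when walking once along the boundary of the face.  A connected
  map is an embedding in the sphere, equivalently in the plane, iff its Euler characteristic is 2.
\<close>

record 'b rotation_system =
  arc_rev :: "'b \<Rightarrow> 'b"
  arc_succ :: "'b \<Rightarrow> 'b"

locale comb_map =
  fin_digraph G + bidirected_digraph G "arc_rev M"
  for G :: "('a, 'b) pre_digraph" and M :: "'b rotation_system" +
  assumes arc_succ_permutes: "arc_succ M permutes arcs G"
    and arc_succ_cyclic: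
      "\<And>v. v \<in> verts G \<Longrightarrow> out_arcs G v \<noteq> {} \<Longrightarrow> cyclic_on (arc_succ M) (out_arcs G v)"

definition face_succ :: "'b rotation_system \<Rightarrow> 'b \<Rightarrow> 'b" where
  "face_succ M = arc_succ M \<circ> arc_rev M"

definition face_of :: "'b rotation_system \<Rightarrow> 'b \<Rightarrow> 'b set" where
  "face_of M a = orbit (face_succ M) a"

definition faces :: "('a, 'b) pre_digraph \<Rightarrow> 'b rotation_system \<Rightarrow> 'b set set" where
  "faces G M = face_of M ` arcs G"

text \<open>
  The single vertex without edges has no orbits and hence is not covered by the Euler condition.
\<close>

definition connected_plane_graph :: "('a, 'b) pre_digraph \<Rightarrow> 'b rotation_system \<Rightarrow> bool" where
  "connected_plane_graph G M \<longleftrightarrow>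
     comb_map G M \<and> Digraph_Component.connected G \<and>
     int (card (verts G)) - int (card (arcs G) div 2) + int (card (faces G M)) = 2"

definition dual_graph :: "('a, 'b) pre_digraph \<Rightarrow> 'b rotation_system \<Rightarrow> ('b set, 'b) pre_digraph" where
  "dual_graph G M =
     \<lparr>verts = faces G M, arcs = arcs G, tail = face_of M, head = face_of M \<circ> arc_rev M\<rparr>"

text \<open>
  Each arc is identified with the dual arc crossing it, so the cyclic order of the dual arcs
  around a face is the order in which the boundary walk of the face meets the primal arcs.
\<close>

definition dual_rotation :: "'b rotation_system \<Rightarrow> 'b rotation_system" where
  "dual_rotation M = \<lparr>arc_rev = arc_rev M, arc_succ = face_succ M\<rparr>"

text \<open>The locale predicate \<open>graph\<close> expresses that the graph is finite and simple.\<close>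

definition fullerene_graph :: "('a, 'b) pre_digraph \<Rightarrow> 'b rotation_system \<Rightarrow> bool" where
  "fullerene_graph G M \<longleftrightarrow>
     graph G \<and> connected_plane_graph G M \<and>
     (\<forall>v \<in> verts G. out_degree G v = 3) \<and>
     bridgeless G (arc_rev M) \<and>
     (\<forall>F \<in> faces G M. \<exists>p. pre_digraph.cycle G p \<and> set p = F \<and> length p \<in> {5, 6})"


section \<open>The triangular lattice and its hexagons\<close>

text \<open>
  The pair \<open>(a, b)\<close> stands for the point \<open>a + b\<omega>\<close> of the plane with \<open>\<omega> = exp(\<i>\<pi>/3)\<close>;
  \<open>dir k\<close> is the direction \<open>\<omega>^k\<close>.
\<close>

type_synonym point = "int \<times> int"

definition dir :: "int \<Rightarrow> point" where
  "dir k = [(1, 0), (0, 1), (-1, 1), (-1, 0), (0, -1), (1, -1)] ! nat (k mod 6)"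

definition tri_lattice :: "(point, point \<times> point) pre_digraph" where
  "tri_lattice =
     \<lparr>verts = UNIV, arcs = {(x, x + dir k) | x k. True}, tail = fst, head = snd\<rparr>"

definition hexagon :: "nat \<Rightarrow> (point, point \<times> point) pre_digraph" where
  "hexagon r = tri_lattice \<restriction> {v. gdist tri_lattice (0, 0) v \<le> ereal (real r)}"

text \<open>The inner faces of the hexagon, as counterclockwise triples (each face occurs three times).\<close>

definition ccw_triangles :: "nat \<Rightarrow> (point \<times> point \<times> point) set" where
  "ccw_triangles r =
     {(x, x + dir k, x + dir (k + 1)) | x k.
        {x, x + dir k, x + dir (k + 1)} \<subseteq> verts (hexagon r)}"

text \<open>
  The outer cycle in counterclockwise order, with indices modulo \<open>6r\<close>: the corner of index \<open>kr\<close>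
  is \<open>r\<omega>^k\<close>, and the vertex of index \<open>kr + j\<close>, \<open>0 \<le> j < r\<close>, is \<open>(r - j)\<omega>^k + j\<omega>^(k+1)\<close>.
\<close>

definition outer :: "nat \<Rightarrow> int \<Rightarrow> point" where
  "outer r i =
     (let k = i div int r; j = i mod int r;
          (a, b) = dir k; (c, d) = dir (k + 1)
      in ((int r - j) * a + j * c, (int r - j) * b + j * d))"


section \<open>Gluing two hexagons\<close>

text \<open>\<open>Inl\<close> marks the copy with centre \<open>a\<close>, \<open>Inr\<close> the copy with centre \<open>b\<close>.\<close>

definition glue_rel :: "nat \<Rightarrow> nat \<Rightarrow> ((point + point) \<times> (point + point)) set" where
  "glue_rel r t = {(Inl (outer r i), Inr (outer r (i + int t))) | i. 1 \<le> i \<and> i \<le> 6 * int r}"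

definition glue_equiv :: "nat \<Rightarrow> nat \<Rightarrow> ((point + point) \<times> (point + point)) set" where
  "glue_equiv r t = (glue_rel r t \<union> (glue_rel r t)\<inverse>)\<^sup>*"

type_synonym glued_vertex = "(point + point) set"

definition glued :: "nat \<Rightarrow> nat \<Rightarrow> point + point \<Rightarrow> glued_vertex" where
  "glued r t x = glue_equiv r t `` {x}"

definition Dstar_graph :: "nat \<Rightarrow> nat \<Rightarrow> (glued_vertex, glued_vertex \<times> glued_vertex) pre_digraph" where
  "Dstar_graph r t =
     \<lparr>verts = glued r t ` (verts (hexagon r) <+> verts (hexagon r)),
      arcs = {(glued r t (Inl x), glued r t (Inl y)) | x y. (x, y) \<in> arcs (hexagon r)} \<union>
             {(glued r t (Inr x), glued r t (Inr y)) | x y. (x, y) \<in> arcs (hexagon r)},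
      tail = fst, head = snd\<rparr>"

text \<open>
  The triangular faces of the glued sphere, oriented consistently: since both hexagons are glued
  along their outer cycles running in the same direction, the second one is turned over, which
  reverses the orientation of its triangles.
\<close>

definition Dstar_triangles :: "nat \<Rightarrow> nat \<Rightarrow> (glued_vertex \<times> glued_vertex \<times> glued_vertex) set" where
  "Dstar_triangles r t =
     {(glued r t (Inl x), glued r t (Inl y), glued r t (Inl z)) | x y z. (x, y, z) \<in> ccw_triangles r} \<union>
     {(glued r t (Inr x), glued r t (Inr z), glued r t (Inr y)) | x y z. (x, y, z) \<in> ccw_triangles r}"

text \<open>
  The edge following \<open>xy\<close> around \<open>x\<close> is \<open>xz\<close>, where \<open>xyz\<close> is the positively oriented triangle
  containing the arc \<open>(x, y)\<close>.
\<close>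

definition Dstar_rotation :: "nat \<Rightarrow> nat \<Rightarrow> (glued_vertex \<times> glued_vertex) rotation_system" where
  "Dstar_rotation r t =
     \<lparr>arc_rev = (\<lambda>(x, y). if (x, y) \<in> arcs (Dstar_graph r t) then (y, x) else (x, y)),
      arc_succ = (\<lambda>(x, y). if (x, y) \<in> arcs (Dstar_graph r t)
                           then (x, THE z. (x, y, z) \<in> Dstar_triangles r t) else (x, y))\<rparr>"

definition D_graph :: "nat \<Rightarrow> nat \<Rightarrow>
    ((glued_vertex \<times> glued_vertex) set, glued_vertex \<times> glued_vertex) pre_digraph" where
  "D_graph r t = dual_graph (Dstar_graph r t) (Dstar_rotation r t)"

definition D_rotation :: "nat \<Rightarrow> nat \<Rightarrow> (glued_vertex \<times> glued_vertex) rotation_system" where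
  "D_rotation r t = dual_rotation (Dstar_rotation r t)"

end

theory Submission
  imports Defs
begin

text \<open>
  Being the dual of a triangulated sphere, \<open>D_graph r t\<close> can be judged from the vertex links of
  the triangulation.  The locale \<open>triangulated_surface\<close> assumes that the neighbours of every vertex
  form a cycle of length 5 or 6, consecutive neighbours spanning a triangle.  It follows that the
  dual is cubic (faces are triangles), its faces are the links and hence pentagons and hexagons, it
  is bridgeless (the rest of a link is a detour around any of its arcs), and it is simple (two
  triangles sharing two sides would leave a vertex of degree 2).  With \<open>36 r\<^sup>2\<close> corners of
  triangles and \<open>6 r\<^sup>2 + 2\<close> vertices the Euler characteristic is 2; this is \<open>dual_fullerene\<close>.

  The hypothesis on links is checked in lattice coordinates.  A point inside one of the two hexagons
  has six neighbours in cyclic order.  For a point on the seam each hexagon contributes a path from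
  the next to the previous point of the outer cycle, with one inner vertex at a corner of that
  hexagon and two otherwise (\<open>rim_link\<close>).  Together the two paths form a cycle, and its length is
  5 or 6 because a shift \<open>t\<close> with \<open>0 < t < r\<close> never puts two corners on top of each other
  (\<open>link_outer\<close>).

  For the diameter, the triangles of one hexagon are arranged in layers \<open>0, ..., 2 r - 2\<close>: layer 0
  consists of the six triangles at the centre, layer \<open>2 r - 2\<close> of those with a side on the outer
  cycle, and every triangle has neighbours in the next higher and the next lower layer, as far as these exist.  Within a hexagon,
  walking through the centre connects layers \<open>d\<close> and \<open>d'\<close> in at most \<open>d + 3 + d'\<close> steps.
  For triangles in different hexagons with \<open>d' \<le> d\<close>, walk from the first one outwards in
  \<open>2 r - 2 - d\<close> steps, cross the seam, and continue through the centre of the second hexagon;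
  this takes at most \<open>(2 r - 2 - d) + 1 + (2 r - 2) + 3 + d' \<le> 4 r\<close> steps.  The point is to
  leave the hexagon from the triangle nearer to the seam (\<open>near_two_caps\<close>).
\<close>

section \<open>Triangulated surfaces and their duals\<close>

text \<open>
  The face of the map that corresponds to the positively oriented triangle \<open>(u, v, w)\<close>: face
  boundaries are orbits of \<open>arc_succ \<circ> arc_rev\<close> and thus run clockwise around their triangle.
\<close>
fun rev_sides :: "'a \<times> 'a \<times> 'a \<Rightarrow> ('a \<times> 'a) set" where
  "rev_sides (u, v, w) = {(v, u), (u, w), (w, v)}"

lemma rev_sides_rotate: "rev_sides (u, v, w) = rev_sides (v, w, u)"
  by auto

text \<open>
  \<open>T\<close> is the set of positively oriented triangles, each listed from all three of its vertices.  The
  assumption \<open>link\<close> makes the triangles at \<open>v\<close> a closed fan around \<open>v\<close>.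
\<close>
locale triangulated_surface =
  fixes V :: "'a set" and E :: "('a \<times> 'a) set" and T :: "('a \<times> 'a \<times> 'a) set"
  assumes finite_V: "finite V"
    and E_subset: "E \<subseteq> V \<times> V"
    and E_sym: "(x, y) \<in> E \<Longrightarrow> (y, x) \<in> E"
    and T_rotate: "(x, y, z) \<in> T \<Longrightarrow> (y, z, x) \<in> T"
    and T_edge: "(x, y, z) \<in> T \<Longrightarrow> (x, y) \<in> E"
    and link: "v \<in> V \<Longrightarrow> \<exists>ns. distinct ns \<and> length ns \<in> {5, 6} \<and> v \<notin> set ns \<and>
                 {y. (v, y) \<in> E} = set ns \<and>
                 {(y, z). (v, y, z) \<in> T} = set (zip ns (rotate1 ns))"
begin

definition graph_of where
  "graph_of = \<lparr>verts = V, arcs = E, tail = fst, head = snd\<rparr>"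

definition rotation_of where
  "rotation_of = \<lparr>arc_rev = (\<lambda>(x, y). if (x, y) \<in> E then (y, x) else (x, y)),
     arc_succ = (\<lambda>(x, y). if (x, y) \<in> E then (x, THE z. (x, y, z) \<in> T) else (x, y))\<rparr>"

abbreviation "rv \<equiv> arc_rev rotation_of"
abbreviation "sc \<equiv> arc_succ rotation_of"
abbreviation "fs \<equiv> face_succ rotation_of"

definition dual where "dual = dual_graph graph_of rotation_of"
definition dual_rot where "dual_rot = dual_rotation rotation_of"

lemma zip_rotate1_eq: "set (zip ns (rotate1 ns)) = {(ns ! i, ns ! (Suc i mod length ns)) |i. i < length ns}"
  by (auto simp: set_zip nth_rotate1)

lemma link_nth:
  assumes "v \<in> V"
  obtains ns where "distinct ns" "length ns \<in> {5, 6}" "v \<notin> set ns"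
    "\<And>y. (v, y) \<in> E \<longleftrightarrow> y \<in> set ns"
    "\<And>y z. (v, y, z) \<in> T \<longleftrightarrow> (\<exists>i<length ns. y = ns ! i \<and> z = ns ! (Suc i mod length ns))"
proof -
  obtain ns where ns: "distinct ns" "length ns \<in> {5, 6}" "v \<notin> set ns"
    "{y. (v, y) \<in> E} = set ns" "{(y, z). (v, y, z) \<in> T} = set (zip ns (rotate1 ns))"
    using link[OF assms] by blast
  have "(v, y, z) \<in> T \<longleftrightarrow> (\<exists>i<length ns. y = ns ! i \<and> z = ns ! (Suc i mod length ns))" for y z
  proof -
    have "(v, y, z) \<in> T \<longleftrightarrow> (y, z) \<in> {(y, z). (v, y, z) \<in> T}" by simp
    then show ?thesis unfolding ns(5) zip_rotate1_eq by auto
  qed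
  with ns show thesis by (intro that[of ns]) blast+
qed

lemma edge_verts: "(x, y) \<in> E \<Longrightarrow> x \<in> V \<and> y \<in> V"
  using E_subset by auto

lemma ex_edge:
  assumes "v \<in> V"
  obtains y where "(v, y) \<in> E"
proof -
  obtain ns where ns: "length ns \<in> {5, 6}" "\<And>y. (v, y) \<in> E \<longleftrightarrow> y \<in> set ns"
    using assms by (rule link_nth) blast
  have "ns ! 0 \<in> set ns" using ns(1) by (intro nth_mem) auto
  with ns(2) that show thesis by blast
qed

lemma edge_irrefl: "(x, y) \<in> E \<Longrightarrow> x \<noteq> y"
  using link_nth edge_verts by metis

text \<open>
  A neighbour of \<open>x\<close> occurs once in the link of \<open>x\<close> and so has one successor there.  This makes the
  definite description in \<open>rotation_of\<close> meaningful.
\<close>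
lemma edge_in_unique_triangle:
  assumes "(x, y) \<in> E"
  shows "\<exists>!z. (x, y, z) \<in> T"
proof -
  from assms have "x \<in> V" using edge_verts by blast
  then obtain ns where ns: "distinct ns"
    "\<And>y. (x, y) \<in> E \<longleftrightarrow> y \<in> set ns"
    "\<And>y z. (x, y, z) \<in> T \<longleftrightarrow> (\<exists>i<length ns. y = ns ! i \<and> z = ns ! (Suc i mod length ns))"
    by (rule link_nth) blast
  from assms ns(2) obtain i where i: "i < length ns" "y = ns ! i"
    by (auto simp: in_set_conv_nth)
  show ?thesis
  proof (rule ex1I)
    show "(x, y, ns ! (Suc i mod length ns)) \<in> T" using i ns(3) by auto
    fix z assume "(x, y, z) \<in> T"
    then obtain j where "j < length ns" "y = ns ! j" "z = ns ! (Suc j mod length ns)"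
      using ns(3) by blast
    with i ns(1) show "z = ns ! (Suc i mod length ns)" by (auto simp: nth_eq_iff_index_eq)
  qed
qed

lemma T_edges:
  assumes "(x, y, z) \<in> T"
  shows "(x, y) \<in> E" "(y, x) \<in> E" "(y, z) \<in> E" "(z, y) \<in> E" "(z, x) \<in> E" "(x, z) \<in> E"
  using assms T_edge T_rotate E_sym by blast+

lemma T_distinct: "(x, y, z) \<in> T \<Longrightarrow> x \<noteq> y \<and> y \<noteq> z \<and> z \<noteq> x"
  using T_edges edge_irrefl by blast

lemma rv: "(x, y) \<in> E \<Longrightarrow> rv (x, y) = (y, x)"
  by (simp add: rotation_of_def)

lemma rv_notin: "a \<notin> E \<Longrightarrow> rv a = a"
  by (cases a) (simp add: rotation_of_def)

lemma rv_rv: "rv (rv a) = a"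
  by (cases a, cases "a \<in> E") (auto simp: rv rv_notin E_sym)

lemma sc: "(x, y, z) \<in> T \<Longrightarrow> sc (x, y) = (x, z)"
  using edge_in_unique_triangle[OF T_edge] T_edge by (fastforce simp: rotation_of_def intro!: the1_equality)

lemma sc_notin: "a \<notin> E \<Longrightarrow> sc a = a"
  by (cases a) (simp add: rotation_of_def)

lemma fs: "(x, y, z) \<in> T \<Longrightarrow> fs (y, x) = (x, z)"
  by (simp add: face_succ_def rv sc T_edges)

lemma fs_sc: "face_succ dual_rot = sc"
  by (auto simp: dual_rot_def dual_rotation_def face_succ_def rv_rv)

lemma finite_E: "finite E"
  using E_subset finite_V by (meson finite_SigmaI finite_subset)

lemma rv_permutes: "rv permutes E"
proof (rule bij_imp_permutes)
  have "rv ` E \<subseteq> E" using E_sym by (auto simp: rv)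
  then show "bij_betw rv E E"
    by (intro bij_betw_byWitness[of _ rv]) (auto simp: rv_rv)
qed (rule rv_notin)

lemma sc_permutes: "sc permutes E"
proof (rule bij_imp_permutes)
  have sub: "sc ` E \<subseteq> E"
  proof (rule image_subsetI)
    fix a assume "a \<in> E"
    then obtain x y z where "a = (x, y)" "(x, y, z) \<in> T" using edge_in_unique_triangle by (cases a) blast
    then show "sc a \<in> E" by (simp add: sc T_edges)
  qed
  have "inj_on sc E"
  proof (rule inj_onI)
    fix a b assume ab: "a \<in> E" "b \<in> E" "sc a = sc b"
    obtain x y x' y' where [simp]: "a = (x, y)" "b = (x', y')" by (cases a, cases b)
    from ab have "(x, y) \<in> E" "(x', y') \<in> E" and eq: "sc (x, y) = sc (x', y')" by simp_all
    then obtain z z' where z: "(x, y, z) \<in> T" "(x', y', z') \<in> T" using edge_in_unique_triangle by blast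
    with eq have [simp]: "x' = x" "z' = z" by (auto simp: sc)
    have "(z, x, y) \<in> T" "(z, x, y') \<in> T" using z T_rotate by auto
    with edge_in_unique_triangle[OF T_edge[OF this(1)]] show "a = b" by auto
  qed
  with sub show "bij_betw sc E E"
    by (simp add: bij_betw_def endo_inj_surj finite_E)
qed (rule sc_notin)

lemma fs_permutes: "fs permutes E"
  unfolding face_succ_def by (rule permutes_compose[OF rv_permutes sc_permutes])

lemma face_of_eq_rev_sides:
  assumes "(u, v, w) \<in> T"
  shows "face_of rotation_of (v, u) = rev_sides (u, v, w)"
proof -
  have "(w, u, v) \<in> T" "(v, w, u) \<in> T" using assms T_rotate by blast+
  then have 1: "fs (v, u) = (u, w)" "fs (u, w) = (w, v)" "fs (w, v) = (v, u)"
    using assms by (auto simp: fs)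
  have "orbit fs (v, u) = {(fs ^^ m) (v, u) |m. m < 3}"
    by (rule orbit_altdef_bounded) (simp_all add: numeral_3_eq_3 1)
  also have "{m. m < (3::nat)} = {0, 1, 2}" by auto
  then have "{(fs ^^ m) (v, u) |m. m < 3} = (\<lambda>m. (fs ^^ m) (v, u)) ` {0, 1, 2}" by blast
  also have "\<dots> = rev_sides (u, v, w)" by (simp add: numeral_2_eq_2 1)
  finally show ?thesis by (simp add: face_of_def)
qed

lemma dual_simps:
  "arcs dual = E" "verts dual = rev_sides ` T"
  "(u, v, w) \<in> T \<Longrightarrow> tail dual (v, u) = rev_sides (u, v, w)"
  "(u, v, w) \<in> T \<Longrightarrow> head dual (u, v) = rev_sides (u, v, w)"
proof -
  have "faces graph_of rotation_of = rev_sides ` T"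
  proof (intro equalityI subsetI)
    fix F assume "F \<in> faces graph_of rotation_of"
    then obtain x y where "(x, y) \<in> E" "F = face_of rotation_of (x, y)"
      by (auto simp: faces_def graph_of_def)
    moreover from this obtain z where "(y, x, z) \<in> T" using edge_in_unique_triangle E_sym by blast
    ultimately show "F \<in> rev_sides ` T" by (auto simp: face_of_eq_rev_sides simp del: rev_sides.simps)
  next
    fix F assume "F \<in> rev_sides ` T"
    then obtain u v w where "(u, v, w) \<in> T" "F = rev_sides (u, v, w)" by auto
    then have "F = face_of rotation_of (v, u)" "(v, u) \<in> E"
      by (simp_all only: face_of_eq_rev_sides T_edges)
    then show "F \<in> faces graph_of rotation_of"
      by (simp add: faces_def graph_of_def)
  qed
  then show "verts dual = rev_sides ` T" by (simp add: dual_def dual_graph_def)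
qed (auto simp: dual_def dual_graph_def graph_of_def face_of_eq_rev_sides rv T_edges simp del: rev_sides.simps)

lemma dual_tail: "tail dual = face_of rotation_of"
  by (simp add: dual_def dual_graph_def)

lemma finite_T: "finite T"
proof -
  have "T \<subseteq> V \<times> V \<times> V"
  proof
    fix \<tau> assume "\<tau> \<in> T"
    then obtain x y z where "\<tau> = (x, y, z)" "(x, y, z) \<in> T" by (cases \<tau>) blast
    then show "\<tau> \<in> V \<times> V \<times> V" using T_edges(1,3) edge_verts by blast
  qed
  then show ?thesis using finite_V by (meson finite_SigmaI finite_subset)
qed

lemma arc_of_dual:
  assumes "a \<in> E"
  obtains u v w w' where "a = (v, u)" "(u, v, w) \<in> T" "(v, u, w') \<in> T"
proof -
  obtain v u where a: "a = (v, u)" by (cases a)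
  with assms obtain w' where "(v, u, w') \<in> T" using edge_in_unique_triangle by blast
  moreover from assms a obtain w where "(u, v, w) \<in> T" using edge_in_unique_triangle E_sym by blast
  ultimately show thesis using a that by blast
qed

sublocale dual: wf_digraph dual
proof
  fix a assume "a \<in> arcs dual"
  then obtain u v w w' where "a = (v, u)" "(u, v, w) \<in> T" "(v, u, w') \<in> T"
    using arc_of_dual by (metis dual_simps(1))
  then show "tail dual a \<in> verts dual" "head dual a \<in> verts dual"
    by (simp_all only: dual_simps(2) dual_simps(3)[of u v w] dual_simps(4)[of v u w'] imageI)
qed

sublocale dual: fin_digraph dual
  by unfold_locales (auto simp: dual_simps finite_E finite_T)

sublocale dual: bidirected_digraph dual rv
proof (rule dual.bidirected_digraphI)
  show "rv a = a" if "a \<notin> arcs dual" for a using that by (simp add: dual_simps rv_notin)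
  show "rv a \<noteq> a" if "a \<in> arcs dual" for a
    using that edge_irrefl by (cases a) (auto simp: dual_simps rv)
  show "rv (rv a) = a" for a by (rule rv_rv)
  show "tail dual (rv a) = head dual a" for a by (simp add: dual_def dual_graph_def)
qed

text \<open>
  The arcs leaving a face in the dual are the arcs on its boundary, since a dual arc is identified
  with the primal arc that it crosses.
\<close>
lemma dual_out_arcs:
  assumes "(u, v, w) \<in> T"
  shows "out_arcs dual (rev_sides (u, v, w)) = rev_sides (u, v, w)"
proof -
  have perm: "permutation fs" using fs_permutes finite_E by (auto simp: permutation_permutes)
  have F: "rev_sides (u, v, w) = orbit fs (v, u)" using face_of_eq_rev_sides[OF assms] by (simp add: face_of_def)
  have sub: "orbit fs (v, u) \<subseteq> E" using permutes_orbit_subset[OF fs_permutes] T_edges[OF assms] by blast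
  have "out_arcs dual (orbit fs (v, u)) = {a \<in> E. orbit fs a = orbit fs (v, u)}"
    by (simp add: out_arcs_def dual_simps(1) dual_tail face_of_def)
  also have "\<dots> = orbit fs (v, u)"
  proof (intro equalityI subsetI)
    fix a assume "a \<in> {a \<in> E. orbit fs a = orbit fs (v, u)}"
    then show "a \<in> orbit fs (v, u)" using permutation_self_in_orbit[OF perm, of a] by simp
  next
    fix a assume a: "a \<in> orbit fs (v, u)"
    have "orbit fs a = orbit fs (v, u)"
      using cyclic_on_orbit'[OF perm] a by (rule orbit_cyclic_eq3)
    with a sub show "a \<in> {a \<in> E. orbit fs a = orbit fs (v, u)}" by blast
  qed
  finally show ?thesis by (simp only: F)
qed

lemma dual_out_degree:
  assumes "F \<in> verts dual"
  shows "out_degree dual F = 3"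
proof -
  from assms obtain u v w where T: "(u, v, w) \<in> T" and F: "F = rev_sides (u, v, w)"
    by (auto simp: dual_simps simp del: rev_sides.simps)
  have "card (rev_sides (u, v, w)) = 3" using T_distinct[OF T] by auto
  then show ?thesis unfolding F by (simp add: out_degree_def dual_out_arcs[OF T] del: rev_sides.simps)
qed

lemma dual_comb_map: "comb_map dual dual_rot"
proof -
  interpret b: bidirected_digraph dual "arc_rev dual_rot"
    using dual.bidirected_digraph by (simp add: dual_rot_def dual_rotation_def)
  show ?thesis
  proof
    show "arc_succ dual_rot permutes arcs dual"
      by (simp add: dual_rot_def dual_rotation_def fs_permutes dual_simps)
  next
    fix F assume "F \<in> verts dual"
    then obtain u v w where T: "(u, v, w) \<in> T" and F: "F = rev_sides (u, v, w)"
      by (auto simp: dual_simps simp del: rev_sides.simps)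
    have "cyclic_on fs (face_of rotation_of (v, u))" unfolding face_of_def
      by (rule cyclic_on_orbit[OF fs_permutes finite_E])
    then show "cyclic_on (arc_succ dual_rot) (out_arcs dual F)"
      unfolding F dual_out_arcs[OF T] by (simp add: dual_rot_def dual_rotation_def face_of_eq_rev_sides[OF T] del: rev_sides.simps)
  qed
qed

text \<open>
  The rotation at \<open>v\<close> runs once through the link of \<open>v\<close>; this is where links enter the cyclic
  structure of the map.
\<close>
lemma sc_orbit:
  assumes "v \<in> V"
  obtains ns where "distinct ns" "length ns \<in> {5, 6}" "\<And>y. (v, y) \<in> E \<longleftrightarrow> y \<in> set ns"
    "\<And>i. (sc ^^ i) (v, ns ! 0) = (v, ns ! (i mod length ns))"
    "\<And>y. y \<in> set ns \<Longrightarrow> orbit sc (v, y) = Pair v ` set ns"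
proof -
  obtain ns where ns: "distinct ns" "length ns \<in> {5, 6}"
    "\<And>y. (v, y) \<in> E \<longleftrightarrow> y \<in> set ns"
    "\<And>y z. (v, y, z) \<in> T \<longleftrightarrow> (\<exists>i<length ns. y = ns ! i \<and> z = ns ! (Suc i mod length ns))"
    using assms by (rule link_nth) blast
  let ?n = "length ns"
  have n: "0 < ?n" using ns(2) by auto
  have step: "sc (v, ns ! i) = (v, ns ! (Suc i mod ?n))" if "i < ?n" for i
    using that ns(4) by (intro sc) blast
  have pow: "(sc ^^ i) (v, ns ! 0) = (v, ns ! (i mod ?n))" for i
    using n by (induct i) (simp_all add: step mod_Suc_eq)
  have orb: "orbit sc (v, ns ! 0) = Pair v ` set ns"
  proof -
    have "orbit sc (v, ns ! 0) = {(sc ^^ m) (v, ns ! 0) |m. m < ?n}"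
      by (rule orbit_altdef_bounded) (use pow n in auto)
    also have "\<dots> = (\<lambda>m. (sc ^^ m) (v, ns ! 0)) ` {..<?n}" by blast
    also have "\<dots> = (\<lambda>m. (v, ns ! m)) ` {..<?n}" by (rule image_cong) (simp_all add: pow)
    also have "\<dots> = Pair v ` set ns" by (auto simp: set_conv_nth)
    finally show ?thesis .
  qed
  have "permutation sc" using sc_permutes finite_E by (auto simp: permutation_permutes)
  then have "cyclic_on sc (Pair v ` set ns)" using cyclic_on_orbit' orb by metis
  then have "orbit sc (v, y) = Pair v ` set ns" if "y \<in> set ns" for y
    using that by (intro orbit_cyclic_eq3) auto
  with ns pow show thesis by (intro that[of ns]) blast+
qed

text \<open>
  Dualizing twice gives back the vertices: by \<open>fs_sc\<close>, walking around a face of the dual is turning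
  around a vertex of the triangulation.
\<close>
lemma dual_faces: "faces dual dual_rot = (\<lambda>v. Pair v ` {y. (v, y) \<in> E}) ` V"
proof (intro equalityI subsetI)
  fix F assume "F \<in> faces dual dual_rot"
  then obtain v y where F: "F = orbit sc (v, y)" and E: "(v, y) \<in> E"
    by (auto simp: faces_def face_of_def fs_sc dual_simps)
  then have v: "v \<in> V" using edge_verts by blast
  then obtain ns where ns: "\<And>y. (v, y) \<in> E \<longleftrightarrow> y \<in> set ns"
    "\<And>y. y \<in> set ns \<Longrightarrow> orbit sc (v, y) = Pair v ` set ns" by (rule sc_orbit) blast
  then have "F = Pair v ` {y. (v, y) \<in> E}" using E F by auto
  with v show "F \<in> (\<lambda>v. Pair v ` {y. (v, y) \<in> E}) ` V" by blast
next
  fix F assume "F \<in> (\<lambda>v. Pair v ` {y. (v, y) \<in> E}) ` V"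
  then obtain v where v: "v \<in> V" and F: "F = Pair v ` {y. (v, y) \<in> E}" by blast
  obtain ns where ns: "length ns \<in> {5, 6}" "\<And>y. (v, y) \<in> E \<longleftrightarrow> y \<in> set ns"
    "\<And>y. y \<in> set ns \<Longrightarrow> orbit sc (v, y) = Pair v ` set ns" using v by (rule sc_orbit) blast
  have "ns ! 0 \<in> set ns" using ns(1) by (intro nth_mem) auto
  then have "F = orbit sc (v, ns ! 0)" "(v, ns ! 0) \<in> E" using F ns by auto
  then show "F \<in> faces dual dual_rot"
    by (auto simp: faces_def face_of_def fs_sc dual_simps)
qed

lemma card_dual_faces: "card (faces dual dual_rot) = card V"
proof -
  have "inj_on (\<lambda>v. Pair v ` {y. (v, y) \<in> E}) V"
  proof (rule inj_onI)
    fix v v' assume v: "v \<in> V" and eq: "Pair v ` {y. (v, y) \<in> E} = Pair v' ` {y. (v', y) \<in> E}"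
    obtain y where "(v, y) \<in> E" using v by (rule ex_edge)
    then have "(v, y) \<in> Pair v' ` {y. (v', y) \<in> E}" using eq by blast
    then show "v = v'" by blast
  qed
  then show ?thesis by (simp add: dual_faces card_image)
qed

lemma card_E: "card E = card T"
proof (rule bij_betw_same_card[symmetric])
  have "inj_on (\<lambda>(x, y, z). (x, y)) T" using edge_in_unique_triangle T_edge by (force intro!: inj_onI)
  moreover have "(\<lambda>(x, y, z). (x, y)) ` T = E" using edge_in_unique_triangle T_edge by (force simp: image_iff)
  ultimately show "bij_betw (\<lambda>(x, y, z). (x, y)) T E" by (simp add: bij_betw_def)
qed

lemma card_dual_verts: "3 * card (verts dual) = card T"
proof -
  have "card (arcs dual) = (\<Sum>F\<in>verts dual. card (out_arcs dual F))"
  proof -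
    have "arcs dual = (\<Union>F\<in>verts dual. out_arcs dual F)" by auto
    also have "card \<dots> = (\<Sum>F\<in>verts dual. card (out_arcs dual F))"
      by (rule card_UN_disjoint) auto
    finally show ?thesis .
  qed
  also have "\<dots> = (\<Sum>F\<in>verts dual. 3)"
    by (rule sum.cong[OF refl]) (use dual_out_degree in \<open>auto simp: out_degree_def\<close>)
  finally show ?thesis by (simp add: dual_simps(1) card_E)
qed

text \<open>
  A return after two steps would mean a link with at most two vertices, but links have at least five.
\<close>
lemma no_digon:
  assumes "(x, y) \<in> E" shows "(sc ^^ 2) (x, y) \<noteq> (x, y)"
proof
  assume eq: "(sc ^^ 2) (x, y) = (x, y)"
  have "x \<in> V" using assms edge_verts by blast
  then obtain ns where ns: "distinct ns" "length ns \<in> {5, 6}" "\<And>y. (x, y) \<in> E \<longleftrightarrow> y \<in> set ns"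
    "\<And>y. y \<in> set ns \<Longrightarrow> orbit sc (x, y) = Pair x ` set ns" by (rule sc_orbit) blast
  have "Pair x ` set ns = {(sc ^^ m) (x, y) |m. m < 2}"
    using orbit_altdef_bounded[OF eq] assms ns by auto
  also have "\<dots> = (\<lambda>m. (sc ^^ m) (x, y)) ` {..<2}" by auto
  also have "card \<dots> \<le> 2" using card_image_le[of "{..<2::nat}"] by auto
  finally have "card (Pair x ` set ns) \<le> 2" .
  moreover have "card (Pair x ` set ns) = length ns"
    using ns(1) by (simp add: card_image inj_on_def distinct_card)
  ultimately show False using ns(2) by auto
qed

lemma dual_loopfree: "loopfree_digraph dual"
proof
  fix a assume "a \<in> arcs dual"
  then obtain u v w w' where a: "a = (v, u)" and T: "(u, v, w) \<in> T" "(v, u, w') \<in> T"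
    using arc_of_dual dual_simps(1) by metis
  have "(u, v) \<in> rev_sides (v, u, w')" by simp
  moreover have "(u, v) \<notin> rev_sides (u, v, w)" using T_distinct[OF T(1)] by auto
  ultimately show "tail dual a \<noteq> head dual a"
    using T dual_simps unfolding a by (metis (no_types))
qed

text \<open>
  If two dual arcs have the same ends, the two triangles share two sides.  Then these triangles alone
  surround the common vertex of the two sides, against \<open>no_digon\<close>.
\<close>
lemma dual_nomulti: "nomulti_digraph dual"
proof
  fix a b assume ab: "a \<in> arcs dual" "b \<in> arcs dual" and eq: "arc_to_ends dual a = arc_to_ends dual b"
  obtain u v w w' where a: "a = (v, u)" and T: "(u, v, w) \<in> T" "(v, u, w') \<in> T"
    using arc_of_dual ab(1) dual_simps(1) by metis
  obtain x y where b: "b = (y, x)" by (cases b)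
  from eq have "tail dual b = rev_sides (u, v, w)" "tail dual (rv b) = rev_sides (v, u, w')"
    using T ab by (auto simp: arc_to_ends_def a dual_simps simp del: rev_sides.simps)
  then have "b \<in> rev_sides (u, v, w)" "rv b \<in> rev_sides (v, u, w')"
    using dual_out_arcs[OF T(1)] dual_out_arcs[OF T(2)] ab
    by (auto simp: out_arcs_def simp del: rev_sides.simps)
  then have bin: "(y, x) \<in> rev_sides (u, v, w)" "(x, y) \<in> rev_sides (v, u, w')"
    using ab(2) by (simp_all add: b rv dual_simps(1) del: rev_sides.simps)
  show "a = b"
  proof (rule ccontr)
    assume ne: "a \<noteq> b"
    have d: "u \<noteq> v" "v \<noteq> w" "w \<noteq> u" "u \<noteq> w'" "v \<noteq> w'" using T_distinct T by blast+
    from bin ne d have "(y, x) = (u, w) \<or> (y, x) = (w, v)" by (auto simp: a b)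
    (* Both triangles contain the side from u to v and a second common side, so they agree in their third vertex. *)
    with bin d have "w' = w" by auto
    with T have "(u, v, w) \<in> T" "(v, u, w) \<in> T" by auto
    then have "(u, v, w) \<in> T" "(u, w, v) \<in> T" using T_rotate by blast+
    then have "sc (u, v) = (u, w)" "sc (u, w) = (u, v)" by (auto intro: sc)
    then have "(sc ^^ 2) (u, v) = (u, v)" by (simp add: numeral_2_eq_2)
    with no_digon T_edge T(1) show False by blast
  qed
qed

lemma dual_graph: "graph dual"
proof -
  interpret loopfree_digraph dual by (rule dual_loopfree)
  interpret nomulti_digraph dual by (rule dual_nomulti)
  have "symmetric dual"
    unfolding symmetric_conv using dual.arev_in_arcs dual.tail_arev dual.head_arev by metis
  then show ?thesis
    by unfold_locales
qed

lemma head_eq_tail_sc: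
  assumes "(v, y) \<in> E" shows "head dual (v, y) = tail dual (sc (v, y))"
proof -
  from assms obtain z where T: "(v, y, z) \<in> T" using edge_in_unique_triangle by blast
  then have "(z, v, y) \<in> T" using T_rotate by blast
  then show ?thesis using T dual_simps(3)[of z v y] dual_simps(4)[OF T] rev_sides_rotate by (metis sc)
qed

lemma sc_walk:
  assumes "(v, y) \<in> E"
  shows "pre_digraph.cas dual (tail dual (v, y)) (map (\<lambda>i. (sc ^^ i) (v, y)) [0..<n]) (tail dual ((sc ^^ n) (v, y)))"
    (is "?cas n")
proof (induct n)
  case (Suc n)
  have "(sc ^^ n) (v, y) \<in> E" using assms by (induct n) (auto simp: permutes_in_image[OF sc_permutes])
  then have "head dual ((sc ^^ n) (v, y)) = tail dual ((sc ^^ Suc n) (v, y))"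
    by (cases "(sc ^^ n) (v, y)") (simp add: head_eq_tail_sc)
  moreover have "dual.awlast (tail dual (v, y)) (map (\<lambda>i. (sc ^^ i) (v, y)) [0..<n]) = tail dual ((sc ^^ n) (v, y))"
    using Suc by (rule dual.awlast_if_cas)
  ultimately show ?case using Suc by simp
qed simp

text \<open>
  The triangles around \<open>v\<close> are pairwise different, because the boundary of a triangle contains just
  one arc with tail \<open>v\<close>.
\<close>
lemma face_eq_tails:
  assumes "(v, y) \<in> E" "(v, z) \<in> E" "tail dual (v, y) = tail dual (v, z)"
  shows "y = z"
proof -
  obtain w where T: "(y, v, w) \<in> T" using assms E_sym edge_in_unique_triangle by blast
  have "(v, z) \<in> out_arcs dual (tail dual (v, y))" using assms by (simp add: dual_simps)
  then have "(v, z) \<in> rev_sides (y, v, w)" by (metis dual_out_arcs dual_simps(3) T)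
  with T_distinct[OF T] show ?thesis by auto
qed

text \<open>
  The boundary of a face of the dual, started at a prescribed arc, is a cycle.  Apart from the face
  condition of fullerene graphs, it supplies the detours that exclude bridges.
\<close>
lemma link_cycle:
  assumes "(v, y) \<in> E"
  obtains p where "pre_digraph.cycle dual p" "set p = {v} \<times> {z. (v, z) \<in> E}" "length p \<in> {5, 6}" "hd p = (v, y)"
    "distinct p" "pre_digraph.awalk dual (tail dual (v, y)) p (tail dual (v, y))"
proof -
  have v: "v \<in> V" using assms edge_verts by blast
  obtain ns where ns: "length ns \<in> {5, 6}" "distinct ns" "\<And>y. (v, y) \<in> E \<longleftrightarrow> y \<in> set ns"
    "v \<in> V" "\<And>i. (sc ^^ i) (v, y) = (v, ns ! (i mod length ns))" "y = ns ! 0"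
  proof -
    obtain ns where ns: "distinct ns" "length ns \<in> {5, 6}" "\<And>y. (v, y) \<in> E \<longleftrightarrow> y \<in> set ns"
      "\<And>i. (sc ^^ i) (v, ns ! 0) = (v, ns ! (i mod length ns))"
      using v by (rule sc_orbit) blast
    have "y \<in> set ns" using assms ns(3) by blast
    then obtain j where j: "j < length ns" "y = ns ! j" by (auto simp: in_set_conv_nth)
    (* The list of neighbours is rotated so that it starts with y. *)
    have "(sc ^^ i) (v, y) = (v, rotate j ns ! (i mod length (rotate j ns)))" for i
    proof -
      have "(v, y) = (sc ^^ j) (v, ns ! 0)" using j ns(4) by simp
      then have "(sc ^^ i) (v, y) = (sc ^^ (j + i)) (v, ns ! 0)"
        by (simp add: funpow_add add.commute[of j])
      also have "\<dots> = (v, rotate j ns ! (i mod length ns))"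
        using ns(2) by (subst nth_rotate) (auto simp: ns(4) mod_add_right_eq)
      finally show ?thesis by simp
    qed
    moreover from this[of 0] have "y = rotate j ns ! 0" using ns(2) by auto
    ultimately show thesis using ns v by (intro that[of "rotate j ns"]) simp_all
  qed
  define p where "p = map (\<lambda>i. (sc ^^ i) (v, y)) [0..<length ns]"
  have p: "p = map (Pair v) ns"
    unfolding p_def by (rule nth_equalityI) (simp_all add: ns(5))
  have ret: "(sc ^^ length ns) (v, y) = (v, y)" using ns(5)[of "length ns"] ns(6) by simp
  have "dual.cas (tail dual (v, y)) p (tail dual (v, y))"
    using sc_walk[OF assms, of "length ns"] unfolding p_def ret .
  moreover have "set p \<subseteq> arcs dual" unfolding p using ns(3) by (auto simp: dual_simps)
  ultimately have walk: "dual.awalk (tail dual (v, y)) p (tail dual (v, y))"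
    using assms by (auto simp: dual.awalk_def dual_simps(1) intro!: dual.tail_in_verts)
  have "ns \<noteq> []" using ns(1) by auto
  then have hd: "hd p = (v, y)" "p \<noteq> []" unfolding p using ns(6) by (simp_all add: hd_map hd_conv_nth)
  have "inj_on (tail dual) (set p)"
  proof (rule inj_onI)
    fix b c assume bc: "b \<in> set p" "c \<in> set p" "tail dual b = tail dual c"
    then obtain y z where "b = (v, y)" "c = (v, z)" "y \<in> set ns" "z \<in> set ns" unfolding p by auto
    with bc(3) ns(3) face_eq_tails show "b = c" by blast
  qed
  moreover have dist: "distinct p" unfolding p using ns(2) by (simp add: distinct_map inj_on_def)
  ultimately have "distinct (map (tail dual) p)" unfolding distinct_map by blast
  moreover have "dual.awalk_verts (tail dual (v, y)) p = map (tail dual) p @ [tail dual (v, y)]"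
    using dual.awlast_of_awalk[OF walk] hd(2) by (simp add: dual.awalk_verts_conv)
  ultimately have "distinct (tl (dual.awalk_verts (tail dual (v, y)) p))"
    using hd by (cases p) auto
  then have "dual.cycle p" unfolding dual.cycle_def using walk hd by blast
  moreover have "set p = {v} \<times> {z. (v, z) \<in> E}" unfolding p using ns(3) by auto
  moreover have "length p \<in> {5, 6}" unfolding p using ns(1) by simp
  ultimately show thesis using that walk hd(1) dist by blast
qed

text \<open>
  Removing an arc from its face boundary leaves a walk between its ends.  This walk also avoids the
  reverse arc, as all its arcs have the same tail in the triangulation.
\<close>
lemma dual_bridgeless: "bridgeless dual (arc_rev dual_rot)"
  unfolding bridgeless_def
proof
  fix a assume a: "a \<in> arcs dual"
  obtain v y where vy: "a = (v, y)" by (cases a)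
  with a have E: "(v, y) \<in> E" by (simp add: dual_simps)
  have rev: "arc_rev dual_rot a = (y, v)" using E by (simp add: dual_rot_def dual_rotation_def rv vy)
  define H where "H = del_edge dual (arc_rev dual_rot) a"
  have H: "verts H = verts dual" "arcs H = E - {a, (y, v)}" "tail H = tail dual" "head H = head dual"
    unfolding H_def del_edge_def rev
    by (simp_all add: pre_digraph.del_arc_simps dual_simps insert_commute)
       (auto simp: pre_digraph.del_arc_simps dual_simps)
  interpret H: wf_digraph H
    by unfold_locales (use H dual.tail_in_verts dual.head_in_verts dual_simps(1) in auto)
  from link_cycle[OF E] obtain p where p: "set p = {v} \<times> {z. (v, z) \<in> E}" "hd p = a"
    "distinct p" "length p \<in> {5, 6}" "dual.awalk (tail dual a) p (tail dual a)" unfolding vy by metis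
  then obtain q where q: "p = a # q" by (cases p) auto
  with p have "dual.awalk (head dual a) q (tail dual a)" by (simp add: dual.awalk_Cons_iff)
  moreover have "set q \<subseteq> E - {a, (y, v)}" using p(1,3) q edge_irrefl[OF E] by auto
  moreover have "H.cas u q w = dual.cas u q w" for u w
    by (induct q arbitrary: u) (simp_all add: H)
  ultimately have "H.awalk (head dual a) q (tail dual a)"
    unfolding H.awalk_def dual.awalk_def H by blast
  then have 1: "head dual a \<rightarrow>\<^sup>*\<^bsub>H\<^esub> tail dual a" by (rule H.reachable_awalkI)
  have "symmetric H"
    unfolding symmetric_conv
  proof
    fix b assume "b \<in> arcs H"
    then have "rv b \<in> arcs H" using vy E by (cases b) (auto simp: H rv E_sym)
    moreover have "tail H b = head H (rv b)" "head H b = tail H (rv b)"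
      using \<open>b \<in> arcs H\<close> by (simp_all add: H dual_simps(1))
    ultimately show "\<exists>c\<in>arcs H. tail H b = head H c \<and> head H b = tail H c" by blast
  qed
  from symmetric_reachable[OF this 1]
  show "tail dual a \<rightarrow>\<^sup>*\<^bsub>del_edge dual (arc_rev dual_rot) a\<^esub> head dual a" unfolding H_def .
qed

text \<open>
  With \<open>3 f = 2 e = card T\<close> for the numbers \<open>f\<close> and \<open>e\<close> of triangles and edges, the assumption
  \<open>euler\<close> is Euler's formula for the triangulation.
\<close>
theorem dual_fullerene:
  assumes conn: "Digraph_Component.connected dual" and euler: "6 * card V = card T + 12"
  shows "fullerene_graph dual dual_rot"
proof -
  have "card (arcs dual) = 2 * (3 * card V - 6)"
    using euler by (simp add: dual_simps(1) card_E)
  then have "card (arcs dual) div 2 = 3 * card V - 6" by simp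
  moreover have "2 \<le> card V" "card (verts dual) = 2 * card V - 4"
    using euler card_dual_verts by linarith+
  ultimately have "int (card (verts dual)) - int (card (arcs dual) div 2) + int (card (faces dual dual_rot)) = 2"
    by (simp add: card_dual_faces of_nat_diff)
  moreover have "\<exists>p. dual.cycle p \<and> set p = F \<and> length p \<in> {5, 6}" if F: "F \<in> faces dual dual_rot" for F
  proof -
    from F obtain v where v: "v \<in> V" "F = {v} \<times> {z. (v, z) \<in> E}"
      unfolding dual_faces by auto
    obtain y where "(v, y) \<in> E" using v(1) by (rule ex_edge)
    from link_cycle[OF this] show ?thesis unfolding v by metis
  qed
  ultimately show ?thesis
    unfolding fullerene_graph_def connected_plane_graph_def
    using dual_graph dual_comb_map conn dual_out_degree dual_bridgeless by blast
qed

section \<open>Distances in the dual\<close>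
definition near :: "nat \<Rightarrow> 'a \<times> 'a \<times> 'a \<Rightarrow> 'a \<times> 'a \<times> 'a \<Rightarrow> bool" where
  "near n \<tau> \<tau>' \<longleftrightarrow> (\<exists>p. dual.awalk (rev_sides \<tau>) p (rev_sides \<tau>') \<and> length p \<le> n)"

lemma near_refl: "\<tau> \<in> T \<Longrightarrow> near 0 \<tau> \<tau>"
  by (auto simp: near_def dual.awalk_Nil_iff dual_simps intro!: exI[of _ "[]"])

lemma near_trans: "near m \<tau> \<tau>' \<Longrightarrow> near n \<tau>' \<tau>'' \<Longrightarrow> near (m + n) \<tau> \<tau>''"
  unfolding near_def by (metis dual.awalk_appendI length_append add_mono)

lemma near_mono: "near m \<tau> \<tau>' \<Longrightarrow> m \<le> n \<Longrightarrow> near n \<tau> \<tau>'"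
  unfolding near_def by (meson order_trans)

lemma near_cong: "rev_sides \<tau> = rev_sides \<sigma> \<Longrightarrow> rev_sides \<tau>' = rev_sides \<sigma>' \<Longrightarrow> near n \<tau> \<tau>' = near n \<sigma> \<sigma>'"
  by (simp add: near_def)

lemma near_common_arc:
  assumes "\<tau> \<in> T" "\<tau>' \<in> T" "(p, q) \<in> rev_sides \<tau>" "(q, p) \<in> rev_sides \<tau>'"
  shows "near 1 \<tau> \<tau>'"
proof -
  have out: "out_arcs dual (rev_sides \<sigma>) = rev_sides \<sigma>" if "\<sigma> \<in> T" for \<sigma>
    using dual_out_arcs that by (cases \<sigma>) blast
  have "(p, q) \<in> out_arcs dual (rev_sides \<tau>)" "(q, p) \<in> out_arcs dual (rev_sides \<tau>')"
    using assms out by simp_all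
  then have pq: "(p, q) \<in> E" "tail dual (p, q) = rev_sides \<tau>" "tail dual (q, p) = rev_sides \<tau>'"
    by (simp_all add: dual_simps(1))
  then have "head dual (p, q) = rev_sides \<tau>'"
    using dual.tail_arev[of "(p, q)"] by (simp add: dual_simps(1) rv)
  with pq assms(2) show ?thesis unfolding near_def
    by (intro exI[of _ "[(p, q)]"]) (auto simp: dual.awalk_simps dual_simps(1,2))
qed

lemma near_sym:
  assumes "near n \<tau> \<tau>'" shows "near n \<tau>' \<tau>"
proof -
  have "\<exists>q. dual.awalk v q u \<and> length q = length p" if "dual.awalk u p v" for u p v
    using that
  proof (induct p arbitrary: u)
    case Nil then show ?case by (auto simp: dual.awalk_Nil_iff intro!: exI[of _ "[]"])
  next
    case (Cons a p)
    then obtain q where "dual.awalk v q (head dual a)" "length q = length p" "a \<in> arcs dual" "u = tail dual a"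
      by (auto simp: dual.awalk_Cons_iff)
    then have "dual.awalk v (q @ [rv a]) u"
      by (intro dual.awalk_appendI[of _ _ "head dual a"]) (auto simp: dual.awalk_simps)
    with \<open>length q = length p\<close> show ?case by (intro exI[of _ "q @ [rv a]"]) simp
  qed
  with assms show ?thesis unfolding near_def by metis
qed

lemma diam_le:
  assumes "\<And>\<tau> \<tau>'. \<tau> \<in> T \<Longrightarrow> \<tau>' \<in> T \<Longrightarrow> near n \<tau> \<tau>'"
  shows "diam dual \<le> ereal (real n)"
  unfolding diam_def gdist_def
proof (intro SUP_least)
  fix F F' assume "F \<in> verts dual" "F' \<in> verts dual"
  then obtain \<tau> \<tau>' where \<tau>: "\<tau> \<in> T" "\<tau>' \<in> T" "F = rev_sides \<tau>" "F' = rev_sides \<tau>'" unfolding dual_simps(2) by blast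
  with assms[OF \<tau>(1,2)] obtain p where p: "dual.awalk F p F'" "length p \<le> n" unfolding near_def by blast
  have "dual.\<mu> (\<lambda>_. 1) F F' \<le> ereal (dual.awalk_cost (\<lambda>_. 1) p)"
    by (rule dual.min_cost_le_walk_cost[OF p(1)])
  also have "\<dots> \<le> ereal (real n)" using p(2) by (simp add: dual.awalk_cost_def sum_list_triv)
  finally show "dual.\<mu> (\<lambda>_. 1) F F' \<le> ereal (real n)" .
qed

lemma connectedI:
  assumes "\<And>\<tau> \<tau>'. \<tau> \<in> T \<Longrightarrow> \<tau>' \<in> T \<Longrightarrow> near n \<tau> \<tau>'" "T \<noteq> {}"
  shows "Digraph_Component.connected dual"
  unfolding connected_conv
proof (intro conjI ballI)
  show "verts dual \<noteq> {}" using assms(2) by (simp add: dual_simps)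
  fix F F' assume "F \<in> verts dual" "F' \<in> verts dual"
  then obtain \<tau> \<tau>' where \<tau>: "\<tau> \<in> T" "\<tau>' \<in> T" "F = rev_sides \<tau>" "F' = rev_sides \<tau>'" unfolding dual_simps(2) by blast
  with assms(1)[OF \<tau>(1,2)] obtain p where p: "dual.awalk F p F'" unfolding near_def by blast
  then have "F \<rightarrow>\<^sup>*\<^bsub>dual\<^esub> F'" by (rule dual.reachable_awalkI)
  then show "(F, F') \<in> rtrancl_on (verts dual) ((arcs_ends dual)\<^sup>s)"
    unfolding reachable_def by (rule rtrancl_on_mono[rotated -1]) (auto simp: symcl_def)
qed

text \<open>
  An abstract form of the diameter bound for two caps \<open>s\<close> glued along their rims, each cap being
  divided into layers \<open>0, ..., m\<close> from its core to its rim.  For triangles in different caps, the walk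
  leaves the cap of the one in the higher layer \<open>d\<close>.  This saves \<open>d\<close> steps on the way to the rim,
  enough to pay for the \<open>d' \<le> d\<close> steps at its other end.
\<close>
lemma near_two_caps:
  fixes D :: "bool \<Rightarrow> nat \<Rightarrow> ('a \<times> 'a \<times> 'a) set"
  assumes D_T: "\<And>s d. D s d \<subseteq> T"
    and down: "\<And>\<tau> s d. \<tau> \<in> D s (Suc d) \<Longrightarrow> \<exists>\<sigma>\<in>D s d. near 1 \<tau> \<sigma>"
    and up: "\<And>\<tau> s d. \<tau> \<in> D s d \<Longrightarrow> d < m \<Longrightarrow> \<exists>\<sigma>\<in>D s (Suc d). near 1 \<tau> \<sigma>"
    and cross: "\<And>\<tau> s. \<tau> \<in> D s m \<Longrightarrow> \<exists>\<sigma>\<in>D (\<not> s) m. near 1 \<tau> \<sigma>"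
    and core: "\<And>\<tau> \<sigma> s. \<tau> \<in> D s 0 \<Longrightarrow> \<sigma> \<in> D s 0 \<Longrightarrow> near 3 \<tau> \<sigma>"
    and \<tau>: "\<tau> \<in> D s d" "d \<le> m" and \<tau>': "\<tau>' \<in> D s' d'" "d' \<le> m"
  shows "near (2 * m + 4) \<tau> \<tau>'"
proof -
  have to_core: "\<exists>\<sigma>\<in>D s 0. near d \<tau> \<sigma>" if "\<tau> \<in> D s d" for \<tau> s d
    using that
  proof (induct d arbitrary: \<tau>)
    case 0
    then have "\<tau> \<in> T" using D_T by blast
    from near_refl[OF this] 0 show ?case by blast
  next
    case (Suc d)
    from down[OF Suc.prems] obtain \<rho> where \<rho>: "\<rho> \<in> D s d" "near 1 \<tau> \<rho>" by blast
    from Suc.hyps[OF \<rho>(1)] obtain \<sigma> where "\<sigma> \<in> D s 0" "near d \<rho> \<sigma>" by blast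
    with near_trans[OF \<rho>(2)] have "near (1 + d) \<tau> \<sigma>" by blast
    with \<open>\<sigma> \<in> D s 0\<close> show ?case by auto
  qed
  have to_rim: "\<exists>\<sigma>\<in>D s m. near (m - d) \<tau> \<sigma>" if "\<tau> \<in> D s d" "d \<le> m" for \<tau> s d
    using that(2,1)
  proof (induct arbitrary: \<tau> rule: inc_induct)
    case base
    then have "\<tau> \<in> T" using D_T by blast
    from near_refl[OF this] base show ?case by auto
  next
    case (step d)
    from up[OF step.prems step.hyps(2)] obtain \<rho> where \<rho>: "\<rho> \<in> D s (Suc d)" "near 1 \<tau> \<rho>" by blast
    from step.hyps(3)[OF \<rho>(1)] obtain \<sigma> where "\<sigma> \<in> D s m" "near (m - Suc d) \<rho> \<sigma>" by blast
    with near_trans[OF \<rho>(2)] have "near (1 + (m - Suc d)) \<tau> \<sigma>" by blast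
    with \<open>\<sigma> \<in> D s m\<close> step.hyps(2) show ?case by (auto simp: Suc_diff_Suc)
  qed
  have same: "near (d + 3 + d') \<tau> \<tau>'" if \<tau>: "\<tau> \<in> D s d" and \<tau>': "\<tau>' \<in> D s d'" for \<tau> \<tau>' s d d'
  proof -
    from to_core[OF \<tau>] to_core[OF \<tau>'] obtain \<sigma> \<sigma>' where
      "\<sigma> \<in> D s 0" "\<sigma>' \<in> D s 0" "near d \<tau> \<sigma>" "near d' \<tau>' \<sigma>'" by blast
    then show ?thesis by (meson core near_trans near_sym)
  qed
  have opposite: "near (2 * m + 4) \<tau> \<tau>'"
    if \<tau>: "\<tau> \<in> D s d" and \<tau>': "\<tau>' \<in> D (\<not> s) d'" and le: "d' \<le> d" "d \<le> m" for \<tau> \<tau>' s d d'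
  proof -
    from to_rim[OF \<tau> le(2)] obtain \<rho> where \<rho>: "\<rho> \<in> D s m" "near (m - d) \<tau> \<rho>" by blast
    from cross[OF \<rho>(1)] obtain \<sigma> where \<sigma>: "\<sigma> \<in> D (\<not> s) m" "near 1 \<rho> \<sigma>" by blast
    have "near (m - d + 1 + (m + 3 + d')) \<tau> \<tau>'"
      by (rule near_trans[OF near_trans[OF \<rho>(2) \<sigma>(2)] same[OF \<sigma>(1) \<tau>']])
    then show ?thesis by (rule near_mono) (use le in simp)
  qed
  consider "s' = s" | "s' = (\<not> s)" by blast
  then show ?thesis
  proof cases
    case 1
    with same[OF \<tau>(1)] \<tau>'(1) have "near (d + 3 + d') \<tau> \<tau>'" by simp
    then show ?thesis by (rule near_mono) (use \<tau>(2) \<tau>'(2) in simp)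
  next
    case 2
    show ?thesis
    proof (cases "d' \<le> d")
      case True
      with opposite[OF \<tau>(1)] \<tau>'(1) \<tau>(2) 2 show ?thesis by simp
    next
      case False
      with opposite[OF \<tau>'(1), of \<tau> d] \<tau>(1) \<tau>'(2) 2 show ?thesis by (simp add: near_sym)
    qed
  qed
qed

end

section \<open>Sector coordinates in the triangular lattice\<close>
lemma dir_cong: "k mod 6 = l mod 6 \<Longrightarrow> dir k = dir l"
  by (simp add: dir_def)

lemma dir_mod: "dir (k mod 6) = dir k"
  by (rule dir_cong) simp

lemma mod6_cases:
  obtains "k mod 6 = (0::int)" | "k mod 6 = 1" | "k mod 6 = 2" | "k mod 6 = 3" | "k mod 6 = 4" | "k mod 6 = 5"
proof -
  have "0 \<le> k mod 6" "k mod 6 < 6" by simp_all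
  then show thesis using that by linarith
qed

lemma dir_eval: "dir 0 = (1, 0)" "dir 1 = (0, 1)" "dir 2 = (-1, 1)" "dir 3 = (-1, 0)" "dir 4 = (0, -1)" "dir 5 = (1, -1)"
  by (simp_all add: dir_def)

lemma dir_step: "dir (k + 2) = dir (k + 1) - dir k"
proof -
  have "dir (k mod 6 + 2) = dir (k mod 6 + 1) - dir (k mod 6)"
    by (cases rule: mod6_cases[of k]) (simp_all add: dir_def)
  moreover have "dir (k mod 6 + c) = dir (k + c)" for c by (rule dir_cong) (simp add: mod_simps)
  ultimately show ?thesis by (simp add: dir_mod)
qed

lemma dir_turn:
  "dir (k + 3) = - dir k" "dir (k + 4) = - dir (k + 1)" "dir (k + 5) = dir k - dir (k + 1)" "dir (k + 6) = dir k"
proof -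
  have 3: "dir (l + 3) = - dir l" for l using dir_step[of "l + 1"] dir_step[of l] by (simp add: add.commute)
  have 4: "dir (k + 4) = - dir (k + 1)" using 3[of "k + 1"] by (simp add: add.commute)
  have 5: "dir (k + 5) = dir k - dir (k + 1)" using 3[of "k + 2"] dir_step[of k] by (simp add: add.commute)
  have 6: "dir (k + 6) = dir k" using 3[of "k + 3"] 3[of k] by (simp add: add.commute)
  show "dir (k + 3) = - dir k" "dir (k + 4) = - dir (k + 1)" "dir (k + 5) = dir k - dir (k + 1)" "dir (k + 6) = dir k"
    by (fact 3 4 5 6)+
qed

text \<open>
  Coordinates of sector \<open>k\<close>, the cone spanned by \<open>dir k\<close> and \<open>dir (k + 1)\<close>.  Since the formulas in
  these coordinates do not depend on \<open>k\<close>, they replace arguments by sixfold symmetry.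
\<close>
definition pt :: "int \<Rightarrow> int \<Rightarrow> int \<Rightarrow> point" where
  "pt k a b = (a * fst (dir k) + b * fst (dir (k + 1)), a * snd (dir k) + b * snd (dir (k + 1)))"

lemma pt_cong: "k mod 6 = l mod 6 \<Longrightarrow> pt k a b = pt l a b"
  unfolding pt_def by (metis dir_cong mod_add_left_eq)

lemma pt_eval:
  "k mod 6 = 0 \<Longrightarrow> pt k a b = (a, b)" "k mod 6 = 1 \<Longrightarrow> pt k a b = (- b, a + b)"
  "k mod 6 = 2 \<Longrightarrow> pt k a b = (- a - b, a)" "k mod 6 = 3 \<Longrightarrow> pt k a b = (- a, - b)"
  "k mod 6 = 4 \<Longrightarrow> pt k a b = (b, - a - b)" "k mod 6 = 5 \<Longrightarrow> pt k a b = (a + b, - a)"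
  using pt_cong[of k "k mod 6" a b] by (simp_all add: pt_def dir_def)

lemma pt_add_dir:
  "pt k a b + dir k = pt k (a + 1) b"
  "pt k a b + dir (k + 1) = pt k a (b + 1)"
  "pt k a b + dir (k + 2) = pt k (a - 1) (b + 1)"
  "pt k a b + dir (k + 3) = pt k (a - 1) b"
  "pt k a b + dir (k + 4) = pt k a (b - 1)"
  "pt k a b + dir (k + 5) = pt k (a + 1) (b - 1)"
  "pt k a b + dir (k + 6) = pt k (a + 1) b"
  by (simp_all add: dir_step dir_turn pt_def prod_eq_iff algebra_simps)

lemma pt_next_sector: "pt (k + 1) a b = pt k (- b) (a + b)"
  by (simp add: pt_def dir_step algebra_simps)

lemma pt_zero [simp]: "pt k 0 0 = (0, 0)"
  by (simp add: pt_def)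

lemma pt_eq_iff [simp]: "pt k a b = pt k c d \<longleftrightarrow> a = c \<and> b = d"
  by (rule mod6_cases[of k]) (auto simp: pt_eval)

lemma pt_surj: "\<exists>a b. x = pt k a b"
proof -
  obtain p q where x: "x = (p, q)" by (cases x)
  show ?thesis
  proof (cases rule: mod6_cases[of k])
    case 1 then show ?thesis by (intro exI[of _ p] exI[of _ q]) (simp add: x pt_eval)
  next
    case 2 then show ?thesis by (intro exI[of _ "p + q"] exI[of _ "- p"]) (simp add: x pt_eval)
  next
    case 3 then show ?thesis by (intro exI[of _ q] exI[of _ "- p - q"]) (simp add: x pt_eval)
  next
    case 4 then show ?thesis by (intro exI[of _ "- p"] exI[of _ "- q"]) (simp add: x pt_eval)
  next
    case 5 then show ?thesis by (intro exI[of _ "- p - q"] exI[of _ p]) (simp add: x pt_eval)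
  next
    case 6 then show ?thesis by (intro exI[of _ "- q"] exI[of _ "p + q"]) (simp add: x pt_eval)
  qed
qed

text \<open>
  The six sectors with \<open>a > 0\<close> and \<open>b \<ge> 0\<close> are half-open cones and partition the lattice without
  its origin; the second disjunct is the origin itself.
\<close>
lemma sector:
  obtains k a b where "x = pt k a b" "0 \<le> b" "0 < a \<or> a = 0 \<and> b = 0"
proof -
  obtain p q where x: "x = (p, q)" by (cases x)
  consider "p > 0" "q \<ge> 0" | "p \<le> 0" "p + q > 0" | "q > 0" "p + q \<le> 0" | "p < 0" "q \<le> 0"
    | "p \<ge> 0" "p + q < 0" | "q < 0" "p + q \<ge> 0" | "p = 0" "q = 0" by linarith
  then show thesis
  proof cases
    case 1 then show thesis by (intro that[of 0 p q]) (auto simp: x pt_eval)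
  next
    case 2 then show thesis by (intro that[of 1 "p + q" "- p"]) (auto simp: x pt_eval)
  next
    case 3 then show thesis by (intro that[of 2 q "- p - q"]) (auto simp: x pt_eval)
  next
    case 4 then show thesis by (intro that[of 3 "- p" "- q"]) (auto simp: x pt_eval)
  next
    case 5 then show thesis by (intro that[of 4 "- p - q" p]) (auto simp: x pt_eval)
  next
    case 6 then show thesis by (intro that[of 5 "- q" "p + q"]) (auto simp: x pt_eval)
  next
    case 7 then show thesis by (intro that[of 0 0 0]) (auto simp: x pt_eval)
  qed
qed

lemma sector_unique:
  assumes "pt k a b = pt l c d" "0 < a" "0 \<le> b" "0 < c" "0 \<le> d"
  shows "k mod 6 = l mod 6" "a = c" "b = d"
proof -
  have "k mod 6 = l mod 6 \<and> a = c \<and> b = d"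
    using assms by (cases rule: mod6_cases[of k]; cases rule: mod6_cases[of l]) (auto simp: pt_eval)
  then show "k mod 6 = l mod 6" "a = c" "b = d" by blast+
qed

text \<open>
  The norm whose unit ball is the regular hexagon with corners \<open>dir k\<close>.
\<close>
definition hnorm :: "point \<Rightarrow> int" where
  "hnorm x = max \<bar>fst x\<bar> (max \<bar>snd x\<bar> \<bar>fst x + snd x\<bar>)"

lemma hnorm_pt: "hnorm (pt k a b) = max \<bar>a\<bar> (max \<bar>b\<bar> \<bar>a + b\<bar>)"
proof -
  have "\<bar>- a - b\<bar> = \<bar>a + b\<bar>" by simp
  then show ?thesis
    by (cases rule: mod6_cases[of k])
       (simp_all add: pt_eval hnorm_def max.assoc max.commute max.left_commute)
qed

lemma hnorm_le_iff: "hnorm x \<le> c \<longleftrightarrow> \<bar>fst x\<bar> \<le> c \<and> \<bar>snd x\<bar> \<le> c \<and> \<bar>fst x + snd x\<bar> \<le> c"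
  by (simp add: hnorm_def)

lemma hnorm_ge: "\<bar>fst x\<bar> \<le> hnorm x" "\<bar>snd x\<bar> \<le> hnorm x" "\<bar>fst x + snd x\<bar> \<le> hnorm x"
  using hnorm_le_iff[of x "hnorm x"] by auto

lemma dir_pt: "dir k = pt k 1 0"
  by (simp add: pt_def)

lemma hnorm_dir: "hnorm (dir k) = 1"
  by (simp add: dir_pt hnorm_pt)

lemma hnorm_add_dir: "hnorm (x + dir k) \<le> hnorm x + 1"
proof -
  have tri: "\<bar>p + q\<bar> \<le> hnorm x + 1" if "\<bar>p\<bar> \<le> hnorm x" "\<bar>q\<bar> \<le> hnorm (dir k)" for p q
    using order_trans[OF abs_triangle_ineq add_mono[OF that]] by (simp add: hnorm_dir)
  have "\<bar>(fst x + snd x) + (fst (dir k) + snd (dir k))\<bar> \<le> hnorm x + 1"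
    by (intro tri hnorm_ge)
  also have "(fst x + snd x) + (fst (dir k) + snd (dir k)) = (fst x + fst (dir k)) + (snd x + snd (dir k))" by simp
  finally show ?thesis by (auto simp: hnorm_le_iff intro!: tri hnorm_ge)
qed

section \<open>Hexagons as balls of the hexagonal norm\<close>

interpretation lat: wf_digraph tri_lattice
  by unfold_locales (simp_all add: tri_lattice_def)

lemma lattice_simps: "verts tri_lattice = UNIV" "tail tri_lattice = fst" "head tri_lattice = snd"
  "(x, x + dir k) \<in> arcs tri_lattice"
  by (simp_all add: tri_lattice_def del: split_paired_Ex) blast

lemma lattice_arc: "a \<in> arcs tri_lattice \<Longrightarrow> \<exists>x k. a = (x, x + dir k)"
  by (auto simp: tri_lattice_def)

lemma hnorm_walk: "lat.awalk u p v \<Longrightarrow> hnorm v \<le> hnorm u + int (length p)"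
proof (induct p arbitrary: u)
  case Nil then show ?case by (simp add: lat.awalk_Nil_iff)
next
  case (Cons a p)
  then have "a \<in> arcs tri_lattice" "u = fst a" "lat.awalk (snd a) p v"
    by (auto simp: lat.awalk_Cons_iff lattice_simps)
  moreover from this obtain k where "snd a = u + dir k" using lattice_arc[of a] by auto
  ultimately show ?case using Cons.hyps[of "snd a"] hnorm_add_dir[of u k] by simp
qed

text \<open>
  In its sector a point can be moved towards the origin by decreasing its first coordinate, which
  decreases the norm by one.
\<close>
lemma walk_hnorm: "hnorm v \<le> int n \<Longrightarrow> \<exists>p. lat.awalk (0, 0) p v \<and> length p \<le> n"
proof (induct n arbitrary: v)
  case 0
  then have "v = (0, 0)" by (auto simp: hnorm_def prod_eq_iff)
  then show ?case by (intro exI[of _ "[]"]) (simp add: lat.awalk_Nil_iff lattice_simps)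
next
  case (Suc n)
  obtain k a b where v: "v = pt k a b" "0 \<le> b" "0 < a \<or> a = 0 \<and> b = 0" by (rule sector)
  show ?case
  proof (cases "a = 0")
    case True
    with v have "v = (0, 0)" by auto
    then show ?thesis by (intro exI[of _ "[]"]) (simp add: lat.awalk_Nil_iff lattice_simps)
  next
    case False
    have "hnorm (pt k (a - 1) b) \<le> int n" using Suc.prems False v by (auto simp: hnorm_pt)
    from Suc.hyps[OF this] obtain p where p: "lat.awalk (0, 0) p (pt k (a - 1) b)" "length p \<le> n" by blast
    have "v = pt k (a - 1) b + dir k" by (simp add: v pt_add_dir)
    then have "lat.awalk (pt k (a - 1) b) [(pt k (a - 1) b, v)] v"
      using lattice_simps(4) by (auto simp: lat.awalk_simps lattice_simps(1-3))
    with p show ?thesis by (intro exI[of _ "p @ [(pt k (a - 1) b, v)]"] conjI lat.awalk_appendI[of _ _ "pt k (a - 1) b"]) auto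
  qed
qed

lemma gdist_lattice: "gdist tri_lattice (0, 0) v \<le> ereal (real r) \<longleftrightarrow> hnorm v \<le> int r"
proof
  assume "hnorm v \<le> int r"
  then obtain p where p: "lat.awalk (0, 0) p v" "length p \<le> r" using walk_hnorm by blast
  have "lat.\<mu> (\<lambda>_. 1) (0, 0) v \<le> ereal (lat.awalk_cost (\<lambda>_. 1) p)"
    by (rule lat.min_cost_le_walk_cost[OF p(1)])
  also have "\<dots> \<le> ereal (real r)" using p(2) by (simp add: lat.awalk_cost_def sum_list_triv)
  finally show "gdist tri_lattice (0, 0) v \<le> ereal (real r)" by (simp add: gdist_def)
next
  assume le: "gdist tri_lattice (0, 0) v \<le> ereal (real r)"
  have "ereal (real_of_int (hnorm v)) \<le> lat.\<mu> (\<lambda>_. 1) (0, 0) v"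
    unfolding lat.\<mu>_def
  proof (rule INF_greatest)
    fix p assume "p \<in> {p. lat.awalk (0, 0) p v}"
    then have "hnorm v \<le> int (length p)" using hnorm_walk[of "(0, 0)" p v] by (simp add: hnorm_def)
    then show "ereal (real_of_int (hnorm v)) \<le> ereal (lat.awalk_cost (\<lambda>_. 1) p)"
      by (simp add: lat.awalk_cost_def sum_list_triv)
  qed
  also have "\<dots> \<le> ereal (real r)" using le by (simp add: gdist_def)
  finally show "hnorm v \<le> int r" by simp
qed

lemma hexagon_verts: "verts (hexagon r) = {x. hnorm x \<le> int r}"
  by (simp add: hexagon_def gdist_lattice)

lemma hexagon_arcs: "arcs (hexagon r) = {(x, x + dir k) |x k. hnorm x \<le> int r \<and> hnorm (x + dir k) \<le> int r}"
  by (auto simp: hexagon_def induce_subgraph_def gdist_lattice) (auto simp: tri_lattice_def)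

lemma ccw_iff: "(x, y, z) \<in> ccw_triangles r \<longleftrightarrow>
   (\<exists>k. y = x + dir k \<and> z = x + dir (k + 1)) \<and> hnorm x \<le> int r \<and> hnorm y \<le> int r \<and> hnorm z \<le> int r"
  by (simp add: ccw_triangles_def hexagon_verts del: split_paired_Ex) blast

lemma ccw_rotate:
  assumes "(x, y, z) \<in> ccw_triangles r" shows "(y, z, x) \<in> ccw_triangles r"
proof -
  obtain k where k: "y = x + dir k" "z = x + dir (k + 1)" using assms by (auto simp: ccw_iff)
  have "z = y + dir (k + 2)" "x = y + dir (k + 2 + 1)"
    using k dir_step[of k] dir_turn(1)[of k] by (simp_all add: algebra_simps)
  then show ?thesis using assms unfolding ccw_iff by blast
qed

section \<open>Counting points and triangles of a hexagon\<close>

lemma sum_abs_int: "2 * (\<Sum>a\<in>{- int m..int n}. \<bar>a\<bar>) = int n * (int n + 1) + int m * (int m + 1)"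
proof (induct m)
  case 0
  show ?case
  proof (induct n)
    case (Suc n)
    have "{- int 0..int (Suc n)} = insert (int (Suc n)) {- int 0..int n}" by auto
    with Suc show ?case by (simp add: algebra_simps)
  qed simp
next
  case (Suc m)
  have "{- int (Suc m)..int n} = insert (- int (Suc m)) {- int m..int n}" by auto
  with Suc show ?case by (simp add: algebra_simps)
qed

text \<open>
  For \<open>n = m\<close> this is the hexagon of side \<open>m\<close>; for \<open>n = m - 1\<close> it is the set of lowest points of the
  upward triangles in that hexagon.  Treating both at once saves a second count.
\<close>
definition hex_region :: "nat \<Rightarrow> nat \<Rightarrow> (int \<times> int) set" where
  "hex_region m n = {(a, b). {a, b, a + b} \<subseteq> {- int m..int n}}"

lemma hex_region_eq:
  "hex_region m n = (SIGMA a:{- int m..int n}. {max (- int m) (- int m - a)..min (int n) (int n - a)})"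
  by (auto simp: hex_region_def)

lemma finite_hex_region: "finite (hex_region m n)"
  unfolding hex_region_eq by (intro finite_SigmaI) auto

lemma card_hex_region:
  "2 * int (card (hex_region m n)) =
     2 * (int m + int n + 1)\<^sup>2 - int n * (int n + 1) - int m * (int m + 1)"
proof -
  have "int (card (hex_region m n)) = (\<Sum>a\<in>{- int m..int n}. int m + int n + 1 - \<bar>a\<bar>)"
    unfolding hex_region_eq by (subst card_SigmaI) (auto intro!: sum.cong)
  also have "\<dots> = (int m + int n + 1)\<^sup>2 - (\<Sum>a\<in>{- int m..int n}. \<bar>a\<bar>)"
    by (simp add: sum_subtractf power2_eq_square algebra_simps)
  finally show ?thesis using sum_abs_int[of m n] by simp
qed

lemma disc_eq_hex_region: "{x. hnorm x \<le> int r} = hex_region r r"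
  by (auto simp: hnorm_def hex_region_def)

lemma finite_disc: "finite {x. hnorm x \<le> int r}"
  by (simp add: disc_eq_hex_region finite_hex_region)

lemma card_disc: "card {x. hnorm x \<le> int r} = 3 * r\<^sup>2 + 3 * r + 1"
proof -
  have "2 * int (card {x. hnorm x \<le> int r}) = 2 * int (3 * r\<^sup>2 + 3 * r + 1)"
    unfolding disc_eq_hex_region card_hex_region by (simp add: power2_eq_square algebra_simps)
  then show ?thesis by (metis mult_cancel_left of_nat_eq_iff zero_neq_numeral)
qed

text \<open>
  Triples sorted by the direction of their first side.  In the coordinates of that direction every
  class looks the same, so it suffices to count one class.
\<close>
lemma ccw_eq_UN: "ccw_triangles r =
  (\<Union>k\<in>{0..<6}. (\<lambda>(a, b). (pt k a b, pt k (a + 1) b, pt k a (b + 1))) `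
      {(a, b). hnorm (pt k a b) \<le> int r \<and> hnorm (pt k (a + 1) b) \<le> int r \<and> hnorm (pt k a (b + 1)) \<le> int r})"
  (is "_ = (\<Union>k\<in>_. ?f k ` ?S k)")
proof (intro equalityI subsetI)
  fix \<tau> assume "\<tau> \<in> ccw_triangles r"
  then obtain x k where \<tau>: "\<tau> = (x, x + dir k, x + dir (k + 1))"
    and h: "hnorm x \<le> int r" "hnorm (x + dir k) \<le> int r" "hnorm (x + dir (k + 1)) \<le> int r"
    by (auto simp: ccw_triangles_def hexagon_verts)
  define l where "l = k mod 6"
  have l: "dir k = dir l" "dir (k + 1) = dir (l + 1)" unfolding l_def
    by (rule dir_cong; simp add: mod_simps)+
  obtain a b where "x = pt l a b" using pt_surj by blast
  then have "\<tau> = ?f l (a, b)" "(a, b) \<in> ?S l" using \<tau> h by (simp_all add: l pt_add_dir)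
  moreover have "l \<in> {0..<6}" by (simp add: l_def)
  ultimately show "\<tau> \<in> (\<Union>k\<in>{0..<6}. ?f k ` ?S k)" by blast
next
  fix \<tau> assume "\<tau> \<in> (\<Union>k\<in>{0..<6}. ?f k ` ?S k)"
  then show "\<tau> \<in> ccw_triangles r"
    by (auto simp: ccw_iff pt_add_dir[symmetric])
qed

lemma card_ccw: "r \<ge> 1 \<Longrightarrow> card (ccw_triangles r) = 18 * r\<^sup>2"
proof -
  assume r: "r \<ge> 1"
  let ?f = "\<lambda>k (a, b). (pt k a b, pt k (a + 1) b, pt k a (b + 1))"
  (* The vertices at a + 1 and b + 1 lower the upper bounds by one and leave the lower bounds unchanged. *)
  have S: "{(a, b). hnorm (pt k a b) \<le> int r \<and> hnorm (pt k (a + 1) b) \<le> int r \<and> hnorm (pt k a (b + 1)) \<le> int r}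
     = hex_region r (r - 1)" for k
    using r by (auto simp: hnorm_pt hex_region_def abs_le_iff of_nat_diff)
  have eq: "ccw_triangles r = (\<Union>k\<in>{0..<6}. ?f k ` hex_region r (r - 1))"
    unfolding ccw_eq_UN S ..
  have inj: "inj_on (?f k) A" for k A by (auto simp: inj_on_def)
  have disj: "?f k ` A \<inter> ?f l ` B = {}" if "k \<in> {0..<6}" "l \<in> {0..<6}" "k \<noteq> l" for k l A B
  proof -
    have "dir k \<noteq> dir l"
      using that sector_unique(1)[of k 1 0 l 1 0] by (auto simp: dir_pt)
    moreover have "dir k = dir l" if "?f k p = ?f l q" for p q
    proof -
      obtain a b c d where [simp]: "p = (a, b)" "q = (c, d)" by (cases p, cases q)
      have "pt k a b + dir k = pt k (a + 1) b" "pt l c d + dir l = pt l (c + 1) d" by (rule pt_add_dir)+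
      with that have "pt k a b = pt l c d" "pt k a b + dir k = pt l c d + dir l" by simp_all
      then show ?thesis by simp
    qed
    ultimately show ?thesis by blast
  qed
  have "card (ccw_triangles r) = (\<Sum>k\<in>{0..<6::int}. card (?f k ` hex_region r (r - 1)))"
    unfolding eq by (rule card_UN_disjoint) (use disj finite_hex_region in auto)
  also have "\<dots> = 6 * card (hex_region r (r - 1))" by (simp add: card_image[OF inj])
  also have "\<dots> = 18 * r\<^sup>2"
  proof -
    have "2 * int (card (hex_region r (r - 1))) = 2 * int (3 * r\<^sup>2)"
      unfolding card_hex_region using r by (simp add: power2_eq_square algebra_simps of_nat_diff)
    then have "card (hex_region r (r - 1)) = 3 * r\<^sup>2" by (metis mult_cancel_left of_nat_eq_iff zero_neq_numeral)
    then show ?thesis by simp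
  qed
  finally show ?thesis .
qed

section \<open>Links in a hexagon\<close>
lemma hexagon_arc_iff: "(x, y) \<in> arcs (hexagon r) \<longleftrightarrow> (\<exists>k. y = x + dir k) \<and> hnorm x \<le> int r \<and> hnorm y \<le> int r"
  by (simp add: hexagon_arcs del: split_paired_Ex) blast

lemma hexagon_arc_sym:
  assumes "(x, y) \<in> arcs (hexagon r)" shows "(y, x) \<in> arcs (hexagon r)"
proof -
  from assms obtain k where k: "y = x + dir k" "hnorm x \<le> int r" "hnorm y \<le> int r"
    unfolding hexagon_arc_iff by blast
  have "x = y + dir (k + 3)" using k(1) by (simp add: dir_turn)
  with k show ?thesis unfolding hexagon_arc_iff by blast
qed

lemma ccw_arcs:
  assumes "(x, y, z) \<in> ccw_triangles r"
  shows "(x, y) \<in> arcs (hexagon r)" "(x, z) \<in> arcs (hexagon r)"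
  using assms unfolding ccw_iff hexagon_arc_iff by blast+

lemma ex_mod6:
  assumes "\<And>k l. k mod 6 = l mod (6::int) \<Longrightarrow> P k = P l"
  shows "(\<exists>l. P l) \<longleftrightarrow> P k \<or> P (k + 1) \<or> P (k + 2) \<or> P (k + 3) \<or> P (k + 4) \<or> P (k + 5)" (is "?L = ?R")
proof
  assume ?L
  then obtain l where l: "P l" ..
  have "(l - k) mod 6 = m \<Longrightarrow> P (k + m)" for m
  proof -
    assume "(l - k) mod 6 = m"
    then have "(k + m) mod 6 = l mod 6" by (metis add.commute diff_add_cancel mod_add_left_eq)
    then show "P (k + m)" using assms l by blast
  qed
  then show ?R by (cases rule: mod6_cases[of "l - k"]) force+
qed blast

text \<open>
  The six candidates are listed starting from an arbitrary direction \<open>k\<close>, so that at a point of the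
  outer cycle the list can be adapted to the sector of that point.
\<close>
lemma ccw_link:
  "(x, y, z) \<in> ccw_triangles r \<longleftrightarrow>
     hnorm x \<le> int r \<and> hnorm y \<le> int r \<and> hnorm z \<le> int r \<and>
     (y = x + dir k \<and> z = x + dir (k + 1) \<or> y = x + dir (k + 1) \<and> z = x + dir (k + 2) \<or>
      y = x + dir (k + 2) \<and> z = x + dir (k + 3) \<or> y = x + dir (k + 3) \<and> z = x + dir (k + 4) \<or>
      y = x + dir (k + 4) \<and> z = x + dir (k + 5) \<or> y = x + dir (k + 5) \<and> z = x + dir (k + 6))"
proof -
  have "(\<exists>l. y = x + dir l \<and> z = x + dir (l + 1)) \<longleftrightarrow>
     (y = x + dir k \<and> z = x + dir (k + 1) \<or> y = x + dir (k + 1) \<and> z = x + dir (k + 1 + 1) \<or>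
      y = x + dir (k + 2) \<and> z = x + dir (k + 2 + 1) \<or> y = x + dir (k + 3) \<and> z = x + dir (k + 3 + 1) \<or>
      y = x + dir (k + 4) \<and> z = x + dir (k + 4 + 1) \<or> y = x + dir (k + 5) \<and> z = x + dir (k + 5 + 1))"
  proof (rule ex_mod6)
    fix k l :: int assume kl: "k mod 6 = l mod 6"
    then have "(k + 1) mod 6 = (l + 1) mod 6" by (metis mod_add_left_eq)
    with kl show "(y = x + dir k \<and> z = x + dir (k + 1)) = (y = x + dir l \<and> z = x + dir (l + 1))"
      using dir_cong by metis
  qed
  then show ?thesis unfolding ccw_iff by (simp only: add.assoc one_add_one numeral_plus_one semiring_norm) blast
qed

lemma arc_link:
  "(x, y) \<in> arcs (hexagon r) \<longleftrightarrow> hnorm x \<le> int r \<and> hnorm y \<le> int r \<and>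
     (y = x + dir k \<or> y = x + dir (k + 1) \<or> y = x + dir (k + 2) \<or> y = x + dir (k + 3) \<or> y = x + dir (k + 4) \<or>
      y = x + dir (k + 5))"
proof -
  have "(\<exists>l. y = x + dir l) \<longleftrightarrow> (y = x + dir k \<or> y = x + dir (k + 1) \<or> y = x + dir (k + 2) \<or>
      y = x + dir (k + 3) \<or> y = x + dir (k + 4) \<or> y = x + dir (k + 5))"
    by (rule ex_mod6) (use dir_cong in metis)
  moreover have "(x, y) \<in> arcs (hexagon r) \<longleftrightarrow> hnorm x \<le> int r \<and> hnorm y \<le> int r \<and> (\<exists>l. y = x + dir l)"
    unfolding hexagon_arc_iff by blast
  ultimately show ?thesis by blast
qed

definition around :: "point \<Rightarrow> point list" where
  "around x = map (\<lambda>k. x + dir k) [0, 1, 2, 3, 4, 5]"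

lemma inner_link:
  assumes "hnorm x < int r"
  shows "distinct (around x)" "length (around x) = 6" "x \<notin> set (around x)"
    and "\<And>p. p \<in> set (around x) \<Longrightarrow> hnorm p \<le> int r"
    and "{y. (x, y) \<in> arcs (hexagon r)} = set (around x)"
    and "{(y, z). (x, y, z) \<in> ccw_triangles r} = set (zip (around x) (rotate1 (around x)))"
proof -
  show "distinct (around x)" "length (around x) = 6"
    by (simp_all add: around_def dir_eval prod_eq_iff)
  show "x \<notin> set (around x)" by (auto simp: around_def dir_eval prod_eq_iff)
  have h: "hnorm (x + dir k) \<le> int r" for k using hnorm_add_dir[of x k] assms by linarith
  then show "hnorm p \<le> int r" if "p \<in> set (around x)" for p using that by (auto simp: around_def)
  have d6: "dir 6 = dir 0" by (rule dir_cong) simp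
  show "{y. (x, y) \<in> arcs (hexagon r)} = set (around x)"
    using assms h by (auto simp: arc_link[where k = 0] around_def)
  show "{(y, z). (x, y, z) \<in> ccw_triangles r} = set (zip (around x) (rotate1 (around x)))"
    using assms h by (auto simp: ccw_link[where k = 0] around_def d6)
qed

section \<open>The outer cycle of a hexagon\<close>

text \<open>
  Both end points \<open>j = 0\<close> and \<open>j = int r\<close> are included: a corner belongs to two sides of the hexagon.
\<close>
lemma outer_pt:
  assumes "r > 0" "0 \<le> j" "j \<le> int r"
  shows "outer r (k * int r + j) = pt k (int r - j) j"
proof (cases "j = int r")
  case True
  have "k * int r + j = (k + 1) * int r" using True by (simp add: algebra_simps)
  then have "outer r (k * int r + j) = pt (k + 1) (int r) 0"
    using assms by (simp add: outer_def Let_def pt_def case_prod_beta)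
  then show ?thesis using True by (simp add: pt_next_sector)
next
  case False
  then have "(k * int r + j) div int r = k" "(k * int r + j) mod int r = j" using assms by simp_all
  then show ?thesis by (simp add: outer_def Let_def pt_def case_prod_beta)
qed

lemma outer_sector:
  assumes "r > 0"
  obtains k j where "i = k * int r + j" "0 \<le> j" "j < int r"
  using assms that[of "i div int r" "i mod int r"] by simp

lemma hnorm_outer: "r > 0 \<Longrightarrow> hnorm (outer r i) = int r"
  by (rule outer_sector[of r i]) (auto simp: outer_pt hnorm_pt)

lemma outer_eq_iff:
  assumes "r > 0"
  shows "outer r i = outer r j \<longleftrightarrow> i mod (6 * int r) = j mod (6 * int r)"
proof -
  obtain k a where i: "i = k * int r + a" "0 \<le> a" "a < int r" using assms by (rule outer_sector)
  obtain l b where j: "j = l * int r + b" "0 \<le> b" "b < int r" using assms by (rule outer_sector)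
  (* The sector number modulo 6 and the position on the side are the digits of the index modulo 6 r. *)
  have md: "(k * int r + a) mod (6 * int r) = (k mod 6) * int r + a" if "0 \<le> a" "a < int r" for k a
  proof -
    have 1: "k = 6 * (k div 6) + k mod 6" by simp
    have "k * int r + a = (k mod 6) * int r + a + (k div 6) * (6 * int r)"
      by (subst 1) (simp only: algebra_simps)
    then have "(k * int r + a) mod (6 * int r) = ((k mod 6) * int r + a) mod (6 * int r)"
      by (simp only: mod_mult_self1)
    also have "\<dots> = (k mod 6) * int r + a"
    proof (rule mod_pos_pos_trivial)
      have "k mod 6 \<le> 5" using pos_mod_bound[of 6 k] by simp
      then have "(k mod 6) * int r \<le> 5 * int r" by (rule mult_right_mono) simp
      then show "(k mod 6) * int r + a < 6 * int r" using that by linarith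
    qed (use that in simp)
    finally show ?thesis .
  qed
  have "outer r i = pt k (int r - a) a" "outer r j = pt l (int r - b) b"
    using i j assms by (simp_all add: outer_pt)
  moreover have "pt k (int r - a) a = pt l (int r - b) b \<longleftrightarrow> k mod 6 = l mod 6 \<and> a = b"
  proof
    assume eq: "pt k (int r - a) a = pt l (int r - b) b"
    show "k mod 6 = l mod 6 \<and> a = b"
      using sector_unique(1)[OF eq] sector_unique(3)[OF eq] i(2,3) j(2,3) by simp
  next
    assume "k mod 6 = l mod 6 \<and> a = b"
    then show "pt k (int r - a) a = pt l (int r - b) b" using pt_cong[of k l] by simp
  qed
  ultimately have "outer r i = outer r j \<longleftrightarrow> k mod 6 = l mod 6 \<and> a = b" by simp
  also have "\<dots> \<longleftrightarrow> (k mod 6) * int r + a = (l mod 6) * int r + b"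
  proof
    assume eq: "(k mod 6) * int r + a = (l mod 6) * int r + b"
    have "((k mod 6) * int r + a) div int r = k mod 6" "((l mod 6) * int r + b) div int r = l mod 6"
      using i j by simp_all
    with eq have "k mod 6 = l mod 6" by simp
    with eq show "k mod 6 = l mod 6 \<and> a = b" by simp
  qed simp
  also have "\<dots> \<longleftrightarrow> i mod (6 * int r) = j mod (6 * int r)"
    using i j md by simp
  finally show ?thesis .
qed

lemma outer_surj:
  assumes "r > 0" "hnorm x = int r"
  obtains i where "x = outer r i"
proof -
  obtain k a b where x: "x = pt k a b" "0 \<le> b" "0 < a \<or> a = 0 \<and> b = 0" by (rule sector)
  with assms have "a = int r - b" "b \<le> int r" by (auto simp: hnorm_pt)
  with x outer_pt[OF assms(1), of b k] show thesis by (intro that[of "k * int r + b"]) simp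
qed

text \<open>
  From a point of the outer cycle the directions \<open>dir k\<close> and \<open>dir (k + 1)\<close> of its sector lead out of the
  hexagon, and at a corner \<open>dir (k + 5)\<close> does so as well.  The remaining neighbours form a path along
  which the triangles at the point are strung, with \<open>ms\<close> as its inner vertices; these lie strictly
  inside the hexagon.
\<close>
lemma rim_link:
  assumes r: "r \<ge> 2"
  obtains ms where "distinct ms" "\<And>p. p \<in> set ms \<Longrightarrow> hnorm p < int r"
    "length ms = (if int r dvd i then 1 else 2)"
    "\<And>y. (outer r i, y) \<in> arcs (hexagon r) \<longleftrightarrow> y = outer r (i + 1) \<or> y = outer r (i - 1) \<or> y \<in> set ms"
    "\<And>y z. (outer r i, y, z) \<in> ccw_triangles r \<longleftrightarrow>
       (y, z) \<in> set (zip (outer r (i + 1) # ms) (ms @ [outer r (i - 1)]))"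
proof -
  obtain k j where i: "i = k * int r + j" "0 \<le> j" "j < int r" using r by (auto intro: outer_sector[of r i])
  define a where "a = int r - j"
  have a: "0 < a" "a + j = int r" using i by (auto simp: a_def)
  have o: "outer r i = pt k a j" using i r by (simp add: outer_pt a_def)
  have o1: "outer r (i + 1) = pt k (a - 1) (j + 1)"
    using i r outer_pt[of r "j + 1" k] by (simp add: a_def algebra_simps)
  note links = arc_link[where k = k] ccw_link[where k = k] pt_add_dir o o1
  show thesis
  proof (cases "j = 0")
    case True
    then have a': "a = int r" by (simp add: a_def)
    have "outer r (i - 1) = pt (k - 1) 1 (int r - 1)"
      using True i r outer_pt[of r "int r - 1" "k - 1"] by (simp add: algebra_simps)
    also have "\<dots> = pt k a (- 1)" using pt_next_sector[of "k - 1" a "- 1"] by (simp add: a')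
    finally have om: "outer r (i - 1) = pt k a (- 1)" .
    have hn: "hnorm (pt k (int r) 0) = int r" "hnorm (pt k (int r + 1) 0) = int r + 1"
      "hnorm (pt k (int r) 1) = int r + 1" "hnorm (pt k (int r - 1) 1) = int r"
      "hnorm (pt k (int r - 1) 0) = int r - 1" "hnorm (pt k (int r) (- 1)) = int r"
      "hnorm (pt k (int r + 1) (- 1)) = int r + 1"
      using r by (simp_all add: hnorm_pt)
    show thesis
    proof (rule that[of "[pt k (a - 1) 0]"])
      show "length [pt k (a - 1) 0] = (if int r dvd i then 1 else 2)" using True i by simp
      show "(outer r i, y) \<in> arcs (hexagon r) \<longleftrightarrow> y = outer r (i + 1) \<or> y = outer r (i - 1) \<or> y \<in> set [pt k (a - 1) 0]" for y
        by (auto simp: links om True hn a')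
      show "(outer r i, y, z) \<in> ccw_triangles r \<longleftrightarrow>
         (y, z) \<in> set (zip (outer r (i + 1) # [pt k (a - 1) 0]) ([pt k (a - 1) 0] @ [outer r (i - 1)]))" for y z
        by (auto simp: links om True hn a')
    qed (auto simp: a' hn)
  next
    case False
    with i have j: "0 < j" by simp
    have om: "outer r (i - 1) = pt k (a + 1) (j - 1)"
      using i r j outer_pt[of r "j - 1" k] by (simp add: a_def algebra_simps)
    have hn: "hnorm (pt k a j) = int r" "hnorm (pt k (a + 1) j) = int r + 1" "hnorm (pt k a (j + 1)) = int r + 1"
      "hnorm (pt k (a - 1) (j + 1)) = int r" "hnorm (pt k (a - 1) j) = int r - 1" "hnorm (pt k a (j - 1)) = int r - 1"
      "hnorm (pt k (a + 1) (j - 1)) = int r"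
      using a j by (simp_all add: hnorm_pt)
    have nd: "\<not> int r dvd i"
    proof
      assume "int r dvd i"
      then have "int r dvd j" using i(1) dvd_add_right_iff[of "int r" "k * int r" j] by simp
      with i j zdvd_imp_le[of "int r" j] show False by simp
    qed
    show thesis
    proof (rule that[of "[pt k (a - 1) j, pt k a (j - 1)]"])
      show "length [pt k (a - 1) j, pt k a (j - 1)] = (if int r dvd i then 1 else 2)" using nd by simp
      show "(outer r i, y) \<in> arcs (hexagon r) \<longleftrightarrow> y = outer r (i + 1) \<or> y = outer r (i - 1) \<or> y \<in> set [pt k (a - 1) j, pt k a (j - 1)]" for y
        by (auto simp: links om hn)
      show "(outer r i, y, z) \<in> ccw_triangles r \<longleftrightarrow>
         (y, z) \<in> set (zip (outer r (i + 1) # [pt k (a - 1) j, pt k a (j - 1)]) ([pt k (a - 1) j, pt k a (j - 1)] @ [outer r (i - 1)]))" for y z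
        by (auto simp: links om hn)
    qed (use hn in auto)
  qed
qed

section \<open>Triangles in sector coordinates\<close>

text \<open>
  The triangles of sector \<open>k\<close>: those with \<open>False\<close> have one vertex nearest to the centre, those
  with \<open>True\<close> have two.
\<close>
fun sector_triangle :: "int \<Rightarrow> int \<Rightarrow> int \<Rightarrow> bool \<Rightarrow> point \<times> point \<times> point" where
  "sector_triangle k a b False = (pt k a b, pt k (a + 1) b, pt k a (b + 1))"
| "sector_triangle k a b True = (pt k (a + 1) b, pt k (a + 1) (b + 1), pt k a (b + 1))"

text \<open>
  The lines bounding the sectors are lattice lines, so no triangle is cut by them.  A triangle given
  by its vertex \<open>x = pt j a b\<close> and a direction is found in sector \<open>j\<close>, except that for \<open>b = 0\<close> it can
  be on the other side of the ray through \<open>x\<close>, in sector \<open>j - 1\<close>.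
\<close>
lemma triangle_in_sector:
  assumes y: "y = x + dir k" and z: "z = x + dir (k + 1)"
  obtains l a b s where "0 \<le> a" "0 \<le> b" "sector_triangle l a b s \<in> {(x, y, z), (y, z, x), (z, x, y)}"
proof -
  obtain j a b where x: "x = pt j a b" "0 \<le> b" "0 < a \<or> a = 0 \<and> b = 0" by (rule sector)
  show thesis
  proof (cases "a = 0")
    case True
    with x have "x = pt k 0 0" by simp
    moreover from this have "y = pt k 1 0" "z = pt k 0 1" using pt_add_dir(1,2)[of k 0 0] y z by simp_all
    ultimately show thesis by (intro that[of 0 0 k False]) simp_all
  next
    case False
    with x have a: "0 < a" by simp
    have prev: "pt j p q = pt (j - 1) (- q) (p + q)" for p q
      using pt_next_sector[of "j - 1" p q] by simp
    have eq: "y = x + dir (j + m)" "z = x + dir (j + (m + 1))" if "(k - j) mod 6 = m" for m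
    proof -
      have jm: "k mod 6 = (j + m) mod 6" unfolding that[symmetric] by (simp add: mod_simps)
      then have "(k + 1) mod 6 = (j + m + 1) mod 6" by (rule mod_add_cong) simp
      with jm y z show "y = x + dir (j + m)" "z = x + dir (j + (m + 1))"
        using dir_cong[of k "j + m"] dir_cong[of "k + 1" "j + (m + 1)"] by (simp_all add: add.assoc)
    qed
    show thesis
    proof (cases rule: mod6_cases[of "k - j"])
      case 1
      have yz: "y = pt j (a + 1) b" "z = pt j a (b + 1)" using eq[OF 1] pt_add_dir[of j a b] by (simp_all add: x)
      show thesis by (rule that[of a b j False]) (use a x in \<open>auto simp: yz\<close>)
    next
      case 2
      have yz: "y = pt j a (b + 1)" "z = pt j (a - 1) (b + 1)" using eq[OF 2] pt_add_dir[of j a b] by (simp_all add: x)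
      show thesis by (rule that[of "a - 1" b j True]) (use a x in \<open>auto simp: yz\<close>)
    next
      case 3
      have yz: "y = pt j (a - 1) (b + 1)" "z = pt j (a - 1) b" using eq[OF 3] pt_add_dir[of j a b] by (simp_all add: x)
      show thesis by (rule that[of "a - 1" b j False]) (use a x in \<open>auto simp: yz\<close>)
    next
      case 4
      have yz: "y = pt j (a - 1) b" "z = pt j a (b - 1)" using eq[OF 4] pt_add_dir[of j a b] by (simp_all add: x)
      show thesis
      proof (cases "b = 0")
        case True
        show thesis by (rule that[of 0 "a - 1" "j - 1" False]) (use a x True in \<open>auto simp: yz prev\<close>)
      next
        case False
        show thesis by (rule that[of "a - 1" "b - 1" j True]) (use a x False in \<open>auto simp: yz\<close>)
      qed
    next
      case 5
      have yz: "y = pt j a (b - 1)" "z = pt j (a + 1) (b - 1)" using eq[OF 5] pt_add_dir[of j a b] by (simp_all add: x)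
      show thesis
      proof (cases "b = 0")
        case True
        show thesis by (rule that[of 0 "a - 1" "j - 1" True]) (use a x True in \<open>auto simp: yz prev\<close>)
      next
        case False
        show thesis by (rule that[of a "b - 1" j False]) (use a x False in \<open>auto simp: yz\<close>)
      qed
    next
      case 6
      have yz: "y = pt j (a + 1) (b - 1)" "z = pt j (a + 1) b" using eq[OF 6] pt_add_dir[of j a b] by (simp_all add: x)
      show thesis
      proof (cases "b = 0")
        case True
        show thesis by (rule that[of 0 a "j - 1" False]) (use a x True in \<open>auto simp: yz prev\<close>)
      next
        case False
        show thesis by (rule that[of a "b - 1" j True]) (use a x False in \<open>auto simp: yz\<close>)
      qed
    qed
  qed
qed

lemma sector_triangle_ccw:
  assumes "0 \<le> a" "0 \<le> b"
  shows "sector_triangle k a b s \<in> ccw_triangles r \<longleftrightarrow> a + b + of_bool s < int r"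
proof (cases s)
  case False
  have "(pt k a b, pt k (a + 1) b, pt k a (b + 1)) \<in> ccw_triangles r \<longleftrightarrow>
     hnorm (pt k a b) \<le> int r \<and> hnorm (pt k (a + 1) b) \<le> int r \<and> hnorm (pt k a (b + 1)) \<le> int r"
    unfolding ccw_link[where k = k] by (simp add: pt_add_dir)
  also have "\<dots> \<longleftrightarrow> a + b + of_bool s < int r"
    using assms False by (simp add: hnorm_pt) linarith
  finally show ?thesis using False by simp
next
  case True
  have "(pt k (a + 1) b, pt k (a + 1) (b + 1), pt k a (b + 1)) \<in> ccw_triangles r \<longleftrightarrow>
     hnorm (pt k (a + 1) b) \<le> int r \<and> hnorm (pt k (a + 1) (b + 1)) \<le> int r \<and> hnorm (pt k a (b + 1)) \<le> int r"
    unfolding ccw_link[where k = k] by (simp add: pt_add_dir)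
  also have "\<dots> \<longleftrightarrow> a + b + of_bool s < int r"
    using assms True by (simp add: hnorm_pt) linarith
  finally show ?thesis using True by simp
qed

section \<open>The glued triangulation\<close>
locale hexagon_gluing =
  fixes r t :: nat
  assumes r_ge: "r \<ge> 2" and t_pos: "1 \<le> t" and t_less: "t \<le> r - 1"
begin

lemma r_pos: "r > 0" using r_ge by simp

lemma outer_shift: "outer r i = outer r j \<longleftrightarrow> outer r (i + c) = outer r (j + c)"
  by (simp add: outer_eq_iff[OF r_pos] mod_eq_dvd_iff)

lemma glue_rel_iff: "(p, q) \<in> glue_rel r t \<longleftrightarrow> (\<exists>i. p = Inl (outer r i) \<and> q = Inr (outer r (i + int t)))"
proof
  assume "\<exists>i. p = Inl (outer r i) \<and> q = Inr (outer r (i + int t))"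
  then obtain i where pq: "p = Inl (outer r i)" "q = Inr (outer r (i + int t))" by blast
  define i' where "i' = (i - 1) mod (6 * int r) + 1"
  have "i' mod (6 * int r) = i mod (6 * int r)" unfolding i'_def by (simp add: mod_simps)
  then have "outer r i = outer r i'" by (simp add: outer_eq_iff[OF r_pos])
  moreover from this have "outer r (i + int t) = outer r (i' + int t)" using outer_shift by blast
  moreover have "0 \<le> (i - 1) mod (6 * int r)" "(i - 1) mod (6 * int r) < 6 * int r" using r_pos by simp_all
  then have "1 \<le> i'" "i' \<le> 6 * int r" unfolding i'_def by simp_all
  ultimately show "(p, q) \<in> glue_rel r t" using pq unfolding glue_rel_def by auto
qed (auto simp: glue_rel_def)

text \<open>
  The relation \<open>glue_rel\<close> is a partial bijection from one copy to the other, so alternating steps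
  along it and its converse only go back and forth.  A class thus has at most two elements.
\<close>
lemma glue_equiv_eq: "glue_equiv r t = Id \<union> glue_rel r t \<union> (glue_rel r t)\<inverse>"
proof -
  let ?R = "glue_rel r t \<union> (glue_rel r t)\<inverse>"
  have right: "p = q" if pq: "(x, p) \<in> glue_rel r t" "(x, q) \<in> glue_rel r t" for x p q
  proof -
    obtain i where i: "x = Inl (outer r i)" "p = Inr (outer r (i + int t))" using pq(1) unfolding glue_rel_iff by blast
    obtain j where j: "x = Inl (outer r j)" "q = Inr (outer r (j + int t))" using pq(2) unfolding glue_rel_iff by blast
    from i j show ?thesis using outer_shift[of i j "int t"] by simp
  qed
  have left: "p = q" if pq: "(p, x) \<in> glue_rel r t" "(q, x) \<in> glue_rel r t" for x p q
  proof -
    obtain i where i: "p = Inl (outer r i)" "x = Inr (outer r (i + int t))" using pq(1) unfolding glue_rel_iff by blast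
    obtain j where j: "q = Inl (outer r j)" "x = Inr (outer r (j + int t))" using pq(2) unfolding glue_rel_iff by blast
    from i j show ?thesis using outer_shift[of i j "int t"] by simp
  qed
  have "\<not> ((p, x) \<in> glue_rel r t \<and> (x, q) \<in> glue_rel r t)" for p x q
    unfolding glue_rel_iff by auto
  then have sub: "?R O ?R \<subseteq> Id" using left right by blast
  have "(p, q) \<in> Id \<union> ?R" if "(p, q) \<in> ?R\<^sup>*" for p q
    using that
  proof (induct rule: rtrancl_induct)
    case (step x y)
    then show ?case using sub by blast
  qed simp
  then have "?R\<^sup>* = Id \<union> ?R" by (intro equalityI subsetI) auto
  then show ?thesis unfolding glue_equiv_def by blast
qed

lemma glued_eq_iff: "glued r t p = glued r t q \<longleftrightarrow> p = q \<or> (p, q) \<in> glue_rel r t \<or> (q, p) \<in> glue_rel r t"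
proof -
  have "equiv UNIV (glue_equiv r t)"
    unfolding glue_equiv_def
    by (intro equivI refl_rtrancl sym_rtrancl trans_rtrancl sym_Un_converse) auto
  then have "glued r t p = glued r t q \<longleftrightarrow> (p, q) \<in> glue_equiv r t"
    unfolding glued_def by (simp add: eq_equiv_class_iff)
  then show ?thesis by (auto simp: glue_equiv_eq)
qed

definition copy_a :: "point \<Rightarrow> glued_vertex" where "copy_a x = glued r t (Inl x)"
definition copy_b :: "point \<Rightarrow> glued_vertex" where "copy_b x = glued r t (Inr x)"

lemma copy_a_eq_iff: "copy_a x = copy_a y \<longleftrightarrow> x = y"
  by (auto simp: copy_a_def glued_eq_iff glue_rel_iff)

lemma copy_b_eq_iff: "copy_b x = copy_b y \<longleftrightarrow> x = y"
  by (auto simp: copy_b_def glued_eq_iff glue_rel_iff)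

lemma copy_a_eq_copy_b_iff: "copy_a x = copy_b y \<longleftrightarrow> (\<exists>i. x = outer r i \<and> y = outer r (i + int t))"
  by (auto simp: copy_a_def copy_b_def glued_eq_iff glue_rel_iff)

lemma copy_a_outer: "copy_a (outer r i) = copy_b (outer r (i + int t))"
  using copy_a_eq_copy_b_iff by blast

lemma copies_disjoint_inside:
  "hnorm x < int r \<Longrightarrow> copy_a x \<noteq> copy_b y" "hnorm y < int r \<Longrightarrow> copy_a x \<noteq> copy_b y"
  using hnorm_outer[OF r_pos] by (auto simp: copy_a_eq_copy_b_iff)

abbreviation "V \<equiv> verts (Dstar_graph r t)"
abbreviation "E \<equiv> arcs (Dstar_graph r t)"
abbreviation "T \<equiv> Dstar_triangles r t"

lemma V_eq: "V = copy_a ` {x. hnorm x \<le> int r} \<union> copy_b ` {x. hnorm x < int r}"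
proof -
  have "V = copy_a ` {x. hnorm x \<le> int r} \<union> copy_b ` {x. hnorm x \<le> int r}"
    by (simp add: Dstar_graph_def hexagon_verts Plus_def image_Un image_image copy_a_def copy_b_def)
  moreover have "copy_b x \<in> copy_a ` {x. hnorm x \<le> int r}" if h: "hnorm x = int r" for x
  proof -
    obtain i where i: "x = outer r i" using h by (rule outer_surj[OF r_pos])
    have "copy_b x = copy_a (outer r (i - int t))" unfolding i copy_a_outer by simp
    moreover have "hnorm (outer r (i - int t)) \<le> int r" by (simp add: hnorm_outer[OF r_pos])
    ultimately show ?thesis by blast
  qed
  ultimately show ?thesis by (auto simp: order_le_less)
qed

lemma E_iff: "(v, w) \<in> E \<longleftrightarrow> (\<exists>x y. (x, y) \<in> arcs (hexagon r) \<and> (v = copy_a x \<and> w = copy_a y \<or> v = copy_b x \<and> w = copy_b y))"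
  by (simp add: Dstar_graph_def copy_a_def copy_b_def del: split_paired_Ex) blast

lemma T_iff: "(u, v, w) \<in> T \<longleftrightarrow> (\<exists>x y z. (x, y, z) \<in> ccw_triangles r \<and>
    (u = copy_a x \<and> v = copy_a y \<and> w = copy_a z \<or> u = copy_b x \<and> v = copy_b z \<and> w = copy_b y))"
  by (simp add: Dstar_triangles_def copy_a_def copy_b_def del: split_paired_Ex) blast

text \<open>
  The fans of the two hexagons at a seam vertex are joined at their common first and last neighbours.
  The second hexagon is turned over, so its fan is traversed backwards and closes the first one
  up to a cycle with \<open>2 + length ms + length ns\<close> vertices.
\<close>
lemma link_outer:
  "\<exists>ns. distinct ns \<and> length ns \<in> {5, 6} \<and> copy_a (outer r i) \<notin> set ns \<and>
      {y. (copy_a (outer r i), y) \<in> E} = set ns \<and>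
      {(y, z). (copy_a (outer r i), y, z) \<in> T} = set (zip ns (rotate1 ns))"
proof -
  define j where "j = i + int t"
  obtain ms where ms: "distinct ms" "\<And>p. p \<in> set ms \<Longrightarrow> hnorm p < int r"
    "length ms = (if int r dvd i then 1 else 2)"
    "\<And>y. (outer r i, y) \<in> arcs (hexagon r) \<longleftrightarrow> y = outer r (i + 1) \<or> y = outer r (i - 1) \<or> y \<in> set ms"
    "\<And>y z. (outer r i, y, z) \<in> ccw_triangles r \<longleftrightarrow>
       (y, z) \<in> set (zip (outer r (i + 1) # ms) (ms @ [outer r (i - 1)]))"
    by (rule rim_link[OF r_ge, of i]) blast
  obtain ns where ns: "distinct ns" "\<And>p. p \<in> set ns \<Longrightarrow> hnorm p < int r"
    "length ns = (if int r dvd j then 1 else 2)"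
    "\<And>y. (outer r j, y) \<in> arcs (hexagon r) \<longleftrightarrow> y = outer r (j + 1) \<or> y = outer r (j - 1) \<or> y \<in> set ns"
    "\<And>y z. (outer r j, y, z) \<in> ccw_triangles r \<longleftrightarrow>
       (y, z) \<in> set (zip (outer r (j + 1) # ns) (ns @ [outer r (j - 1)]))"
    by (rule rim_link[OF r_ge, of j]) blast
  (* A seam vertex cannot be a corner of both hexagons, as its two indices differ by t with 0 < t < r. *)
  have nd: "\<not> (int r dvd i \<and> int r dvd j)"
  proof
    assume "int r dvd i \<and> int r dvd j"
    then have "int r dvd (i + int t) - i" unfolding j_def using dvd_diff by blast
    then have "int r dvd int t" by simp
    then have "r \<le> t" using t_pos by (intro dvd_imp_le) auto
    then show False using t_less t_pos by simp
  qed
  define v where "v = copy_a (outer r i)"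
  have v: "v = copy_a x \<longleftrightarrow> x = outer r i" "v = copy_b x \<longleftrightarrow> x = outer r j" for x
    by (auto simp: v_def copy_a_eq_iff) (auto simp: copy_a_outer copy_b_eq_iff j_def)
  have seam: "copy_b (outer r (j + 1)) = copy_a (outer r (i + 1))" "copy_b (outer r (j - 1)) = copy_a (outer r (i - 1))"
    by (simp_all add: copy_a_outer j_def algebra_simps)
  have E: "(v, w) \<in> E \<longleftrightarrow> w \<in> copy_a ` set ms \<union> copy_b ` set ns \<union> {copy_a (outer r (i + 1)), copy_a (outer r (i - 1))}" for w
  proof -
    have "(v, w) \<in> E \<longleftrightarrow> (\<exists>y. (outer r i, y) \<in> arcs (hexagon r) \<and> w = copy_a y) \<or> (\<exists>y. (outer r j, y) \<in> arcs (hexagon r) \<and> w = copy_b y)"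
      unfolding E_iff v by blast
    then show ?thesis unfolding ms(4) ns(4) image_iff Un_iff insert_iff Bex_def using seam by blast
  qed
  have T: "(v, w, w') \<in> T \<longleftrightarrow>
     (w, w') \<in> set (zip (copy_a (outer r (i + 1)) # map copy_a ms) (map copy_a ms @ [copy_a (outer r (i - 1))])) \<or>
     (w', w) \<in> set (zip (copy_a (outer r (i + 1)) # map copy_b ns) (map copy_b ns @ [copy_a (outer r (i - 1))]))" for w w'
  proof -
    have "(v, w, w') \<in> T \<longleftrightarrow> (\<exists>y z. (outer r i, y, z) \<in> ccw_triangles r \<and> w = copy_a y \<and> w' = copy_a z) \<or>
       (\<exists>y z. (outer r j, y, z) \<in> ccw_triangles r \<and> w = copy_b z \<and> w' = copy_b y)"
      unfolding T_iff v by blast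
    also have "\<dots> \<longleftrightarrow> (w, w') \<in> map_prod copy_a copy_a ` set (zip (outer r (i + 1) # ms) (ms @ [outer r (i - 1)])) \<or>
       (w', w) \<in> map_prod copy_b copy_b ` set (zip (outer r (j + 1) # ns) (ns @ [outer r (j - 1)]))"
      unfolding ms(5) ns(5) image_iff Bex_def by (simp only: split_paired_Ex map_prod_simp prod.inject) blast
    finally show ?thesis
      unfolding set_map[symmetric] map_prod_def zip_map_map[symmetric] by (simp add: seam)
  qed
  have ne: "outer r i \<noteq> outer r (i + 1)" "outer r i \<noteq> outer r (i - 1)" "outer r (i + 1) \<noteq> outer r (i - 1)"
  proof -
    (* Indices of the three points differ by 1 or 2, but only multiples of 6 r identify points. *)
    have "\<not> 6 * int r dvd c" if c: "\<bar>c\<bar> \<in> {1, 2}" for c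
    proof
      assume "6 * int r dvd c"
      moreover have "c \<noteq> 0" using c by auto
      ultimately have "\<bar>6 * int r\<bar> \<le> \<bar>c\<bar>" by (rule dvd_imp_le_int[rotated])
      with c r_ge show False by auto
    qed
    from this[of "-1"] this[of 1] this[of 2]
    show "outer r i \<noteq> outer r (i + 1)" "outer r i \<noteq> outer r (i - 1)" "outer r (i + 1) \<noteq> outer r (i - 1)"
      by (simp_all add: outer_eq_iff[OF r_pos] mod_eq_dvd_iff)
  qed
  define ks where "ks = copy_a (outer r (i + 1)) # map copy_a ms @ copy_a (outer r (i - 1)) # rev (map copy_b ns)"
  have rim: "copy_a (outer r k) \<notin> copy_a ` set ms" "copy_a (outer r k) \<notin> copy_b ` set ns" for k
  proof -
    show "copy_a (outer r k) \<notin> copy_a ` set ms"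
      using ms(2)[of "outer r k"] hnorm_outer[OF r_pos, of k] by (auto simp: copy_a_eq_iff)
    show "copy_a (outer r k) \<notin> copy_b ` set ns" using copies_disjoint_inside(2) ns(2) unfolding image_iff by blast
  qed
  have disj: "copy_a ` set ms \<inter> copy_b ` set ns = {}" using copies_disjoint_inside(2) ns(2) by blast
  have "distinct (map copy_a ms)" "distinct (map copy_b ns)"
    using ms(1) ns(1) by (simp_all add: distinct_map inj_on_def copy_a_eq_iff copy_b_eq_iff)
  then have "distinct ks" using rim ne disj by (simp add: ks_def copy_a_eq_iff)
  moreover have "length ks \<in> {5, 6}" using ms(3) ns(3) nd by (auto simp: ks_def)
  moreover have "v \<notin> set ks" using ne rim by (simp add: ks_def v_def copy_a_eq_iff)
  moreover have "{y. (v, y) \<in> E} = set ks" unfolding E by (auto simp: ks_def)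
  moreover have "{(y, z). (v, y, z) \<in> T} = set (zip ks (rotate1 ks))"
  proof -
    have "(\<exists>a. ms = [a]) \<or> (\<exists>a b. ms = [a, b])" "(\<exists>a. ns = [a]) \<or> (\<exists>a b. ns = [a, b])"
      using ms(3) ns(3) by (auto simp: length_Suc_conv numeral_2_eq_2 split: if_splits)
    then have "(v, w, w') \<in> T \<longleftrightarrow> (w, w') \<in> set (zip ks (rotate1 ks))" for w w'
      unfolding T by (elim disjE exE; simp add: ks_def disj_ac conj_ac)
    then show ?thesis by simp
  qed
  ultimately show ?thesis unfolding v_def by blast
qed

lemma zip_rotate1_rev6:
  assumes "length ns = 6"
  shows "set (zip (rev ns) (rotate1 (rev ns))) = prod.swap ` set (zip ns (rotate1 ns))"
proof -
  obtain a b c d e f where "ns = [a, b, c, d, e, f]"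
    using assms by (auto simp: length_Suc_conv numeral_eq_Suc)
  then show ?thesis by auto
qed

lemma link_inner:
  assumes x: "hnorm x < int r" and v: "v = copy_a x \<or> v = copy_b x"
  shows "\<exists>ns. distinct ns \<and> length ns \<in> {5, 6} \<and> v \<notin> set ns \<and>
      {y. (v, y) \<in> E} = set ns \<and> {(y, z). (v, y, z) \<in> T} = set (zip ns (rotate1 ns))"
  using v
proof
  note L = inner_link[OF x]
  assume "v = copy_a x"
  then have v: "v = copy_a y \<longleftrightarrow> x = y" "v = copy_b y \<longleftrightarrow> False" for y using copies_disjoint_inside(1)[OF x] by (auto simp: copy_a_eq_iff)
  have "(v, w) \<in> E \<longleftrightarrow> w \<in> copy_a ` {y. (x, y) \<in> arcs (hexagon r)}" for w
    unfolding E_iff image_iff v by blast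
  then have E: "{y. (v, y) \<in> E} = copy_a ` {y. (x, y) \<in> arcs (hexagon r)}" by blast
  have "(v, w, w') \<in> T \<longleftrightarrow> (w, w') \<in> map_prod copy_a copy_a ` {(y, z). (x, y, z) \<in> ccw_triangles r}" for w w'
  proof -
    have "(v, w, w') \<in> T \<longleftrightarrow> (\<exists>y z. (x, y, z) \<in> ccw_triangles r \<and> w = copy_a y \<and> w' = copy_a z)"
      unfolding T_iff v by blast
    then show ?thesis by (force simp: image_iff)
  qed
  then have T: "{(y, z). (v, y, z) \<in> T} = map_prod copy_a copy_a ` {(y, z). (x, y, z) \<in> ccw_triangles r}" by simp
  have "{(y, z). (v, y, z) \<in> T} = set (zip (map copy_a (around x)) (rotate1 (map copy_a (around x))))"
    unfolding T L(6) rotate1_map zip_map_map set_map by (rule image_cong) auto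
  with L E show ?thesis
    by (intro exI[of _ "map copy_a (around x)"]) (auto simp: distinct_map inj_on_def copy_a_eq_iff v)
next
  note L = inner_link[OF x]
  assume "v = copy_b x"
  then have v: "v = copy_b y \<longleftrightarrow> x = y" "v = copy_a y \<longleftrightarrow> False" for y
    using copies_disjoint_inside(2)[OF x, of y] by (simp_all add: copy_b_eq_iff eq_commute[of "copy_b x"])
  have "(v, w) \<in> E \<longleftrightarrow> w \<in> copy_b ` {y. (x, y) \<in> arcs (hexagon r)}" for w
    unfolding E_iff image_iff v by blast
  then have E: "{y. (v, y) \<in> E} = copy_b ` {y. (x, y) \<in> arcs (hexagon r)}" by blast
  have "(v, w, w') \<in> T \<longleftrightarrow> (w, w') \<in> map_prod copy_b copy_b ` prod.swap ` {(y, z). (x, y, z) \<in> ccw_triangles r}" for w w'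
  proof -
    have "(v, w, w') \<in> T \<longleftrightarrow> (\<exists>y z. (x, y, z) \<in> ccw_triangles r \<and> w = copy_b z \<and> w' = copy_b y)"
      unfolding T_iff v by blast
    then show ?thesis by (force simp: image_iff)
  qed
  then have T: "{(y, z). (v, y, z) \<in> T} = map_prod copy_b copy_b ` prod.swap ` {(y, z). (x, y, z) \<in> ccw_triangles r}" by simp
  let ?ns = "map copy_b (rev (around x))"
  have "{(y, z). (v, y, z) \<in> T} = set (zip ?ns (rotate1 ?ns))"
    unfolding T L(6) zip_rotate1_rev6[OF L(2), symmetric] rotate1_map zip_map_map set_map by (rule image_cong) auto
  with L E show ?thesis
    by (intro exI[of _ ?ns]) (auto simp: distinct_map inj_on_def copy_b_eq_iff v)
qed

text \<open>
  Hence a glued triangle comes from just one of the two hexagons, and the triangles of the two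
  hexagons can be counted separately.
\<close>
lemma triangle_not_on_rim:
  assumes "(x, y, z) \<in> ccw_triangles r"
  shows "hnorm x < int r \<or> hnorm y < int r \<or> hnorm z < int r"
proof (rule ccontr)
  assume not: "\<not> ?thesis"
  have "hnorm x \<le> int r" using assms by (simp add: ccw_iff)
  with not have "hnorm x = int r" by simp
  then obtain i where i: "x = outer r i" by (rule outer_surj[OF r_pos])
  obtain ms where ms: "\<And>p. p \<in> set ms \<Longrightarrow> hnorm p < int r" "length ms = (if int r dvd i then 1 else 2)"
    "\<And>y z. (outer r i, y, z) \<in> ccw_triangles r \<longleftrightarrow>
       (y, z) \<in> set (zip (outer r (i + 1) # ms) (ms @ [outer r (i - 1)]))"
    by (rule rim_link[OF r_ge, of i]) blast
  from ms(2) have "ms \<noteq> []" by (auto split: if_splits)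
  then obtain m ms' where "ms = m # ms'" by (cases ms) auto
  with assms ms(3)[of y z] have "y \<in> set ms \<or> z = m" unfolding i by (auto dest: set_zip_leftD)
  with ms(1)[of y] ms(1)[of m] not \<open>ms = m # ms'\<close> show False by auto
qed

end

sublocale hexagon_gluing \<subseteq> triangulated_surface "verts (Dstar_graph r t)" "arcs (Dstar_graph r t)" "Dstar_triangles r t"
proof
  show "finite V"
  proof -
    have "finite {x. hnorm x < int r}" by (rule finite_subset[OF _ finite_disc[of r]]) auto
    then show ?thesis unfolding V_eq using finite_disc[of r] by blast
  qed
  have in_V: "copy_a x \<in> V" "copy_b x \<in> V" if "hnorm x \<le> int r" for x
    using that by (auto simp: Dstar_graph_def hexagon_verts copy_a_def copy_b_def)
  show "E \<subseteq> V \<times> V"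
  proof
    fix vw assume "vw \<in> E"
    moreover obtain v w where vw: "vw = (v, w)" by (cases vw)
    ultimately obtain x y where "(x, y) \<in> arcs (hexagon r)" "vw = (copy_a x, copy_a y) \<or> vw = (copy_b x, copy_b y)"
      unfolding vw E_iff by blast
    then show "vw \<in> V \<times> V" using in_V unfolding hexagon_arc_iff by blast
  qed
  show "(w, v) \<in> E" if "(v, w) \<in> E" for v w
    using that hexagon_arc_sym unfolding E_iff by blast
  show "(v, w, u) \<in> T" if "(u, v, w) \<in> T" for u v w
    using that ccw_rotate unfolding T_iff by blast
  show "(u, v) \<in> E" if "(u, v, w) \<in> T" for u v w
  proof -
    from that obtain x y z where xyz: "(x, y, z) \<in> ccw_triangles r"
      "u = copy_a x \<and> v = copy_a y \<and> w = copy_a z \<or> u = copy_b x \<and> v = copy_b z \<and> w = copy_b y" unfolding T_iff by blast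
    from ccw_arcs[OF xyz(1)] xyz(2) show ?thesis unfolding E_iff by blast
  qed
  show "\<exists>ns. distinct ns \<and> length ns \<in> {5, 6} \<and> v \<notin> set ns \<and>
      {y. (v, y) \<in> E} = set ns \<and> {(y, z). (v, y, z) \<in> T} = set (zip ns (rotate1 ns))" if "v \<in> V" for v
  proof -
    from that consider x where "hnorm x < int r" "v = copy_a x \<or> v = copy_b x" | x where "hnorm x = int r" "v = copy_a x"
      unfolding V_eq image_iff Un_iff mem_Collect_eq Bex_def order_le_less by blast
    then show ?thesis
    proof cases
      case 1 then show ?thesis by (rule link_inner)
    next
      case 2
      then obtain i where "x = outer r i" using outer_surj[OF r_pos] by blast
      with 2 link_outer show ?thesis by blast
    qed
  qed
qed

context hexagon_gluing
begin

lemma D_graph_eq: "D_graph r t = dual" "D_rotation r t = dual_rot"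
proof -
  have "graph_of = Dstar_graph r t" unfolding graph_of_def by (simp add: Dstar_graph_def)
  moreover have "rotation_of = Dstar_rotation r t" unfolding rotation_of_def Dstar_rotation_def ..
  ultimately show "D_graph r t = dual" "D_rotation r t = dual_rot"
    by (simp_all add: D_graph_def D_rotation_def dual_def dual_rot_def)
qed

text \<open>
  One full hexagon of side \<open>r\<close> and the interior of the other, which is a hexagon of side \<open>r - 1\<close>.
\<close>
lemma card_V: "card V = 6 * r\<^sup>2 + 2"
proof -
  have inner: "{x. hnorm x < int r} = {x. hnorm x \<le> int (r - 1)}" using r_pos by auto
  have "card V = card (copy_a ` {x. hnorm x \<le> int r}) + card (copy_b ` {x. hnorm x < int r})"
    unfolding V_eq
  proof (rule card_Un_disjoint)
    show "finite (copy_b ` {x. hnorm x < int r})" unfolding inner by (simp add: finite_disc)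
    show "copy_a ` {x. hnorm x \<le> int r} \<inter> copy_b ` {x. hnorm x < int r} = {}" using copies_disjoint_inside(2) by blast
  qed (simp add: finite_disc)
  also have "\<dots> = card {x. hnorm x \<le> int r} + card {x. hnorm x \<le> int (r - 1)}"
    unfolding inner by (simp add: card_image inj_on_def copy_a_eq_iff copy_b_eq_iff)
  also have "\<dots> = 6 * r\<^sup>2 + 2"
  proof -
    obtain q where q: "r = Suc q" using r_pos gr0_conv_Suc by blast
    show ?thesis unfolding card_disc q by (simp add: power2_eq_square)
  qed
  finally show ?thesis .
qed

section \<open>Layers and the diameter\<close>

text \<open>
  \<open>True\<close> stands for the second hexagon, which is turned over; exchanging two vertices restores the
  positive orientation.
\<close>
fun place :: "bool \<Rightarrow> point \<times> point \<times> point \<Rightarrow> glued_vertex \<times> glued_vertex \<times> glued_vertex" where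
  "place False (x, y, z) = (copy_a x, copy_a y, copy_a z)"
| "place True (x, y, z) = (copy_b x, copy_b z, copy_b y)"

lemma T_place: "T = place False ` ccw_triangles r \<union> place True ` ccw_triangles r"
proof (rule set_eqI)
  fix \<tau> :: "glued_vertex \<times> glued_vertex \<times> glued_vertex"
  obtain u v w where "\<tau> = (u, v, w)" by (cases \<tau>)
  then show "\<tau> \<in> T \<longleftrightarrow> \<tau> \<in> place False ` ccw_triangles r \<union> place True ` ccw_triangles r"
    by (simp add: T_iff image_iff Bex_def) blast
qed

lemma place_in_T: "\<tau> \<in> ccw_triangles r \<Longrightarrow> place s \<tau> \<in> T"
  unfolding T_place by (cases s) auto

lemma finite_ccw: "finite (ccw_triangles r)"
  using card_ccw[of r] r_pos by (intro card_ge_0_finite) simp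

lemma card_T: "card T = 36 * r\<^sup>2"
proof -
  have inj: "inj (place s)" for s
    by (cases s) (auto simp: inj_def copy_a_eq_iff copy_b_eq_iff)
  have "place False \<tau> \<noteq> place True \<tau>'" if "\<tau> \<in> ccw_triangles r" for \<tau> \<tau>'
  proof
    assume eq: "place False \<tau> = place True \<tau>'"
    obtain x y z x' y' z' where [simp]: "\<tau> = (x, y, z)" "\<tau>' = (x', y', z')" by (cases \<tau>, cases \<tau>')
    from eq have "copy_a x = copy_b x'" "copy_a y = copy_b z'" "copy_a z = copy_b y'" by simp_all
    with copies_disjoint_inside(1)[of x x'] copies_disjoint_inside(1)[of y z'] copies_disjoint_inside(1)[of z y']
    show False using triangle_not_on_rim[of x y z] that by auto
  qed
  then have "place False ` ccw_triangles r \<inter> place True ` ccw_triangles r = {}" by blast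
  then have "card T = card (place False ` ccw_triangles r) + card (place True ` ccw_triangles r)"
    unfolding T_place by (intro card_Un_disjoint finite_imageI finite_ccw)
  also have "\<dots> = 36 * r\<^sup>2" using card_ccw[of r] r_pos by (simp add: card_image inj_on_subset[OF inj])
  finally show ?thesis .
qed

text \<open>
  Adjacency of triangles can be checked in the lattice, for both hexagons at once.
\<close>
lemma near_place:
  assumes "\<tau> \<in> ccw_triangles r" "\<tau>' \<in> ccw_triangles r" "(p, q) \<in> rev_sides \<tau>" "(q, p) \<in> rev_sides \<tau>'"
  shows "near 1 (place s \<tau>) (place s \<tau>')"
proof -
  obtain x y z x' y' z' where \<tau>: "\<tau> = (x, y, z)" "\<tau>' = (x', y', z')" by (cases \<tau>, cases \<tau>')
  note T = place_in_T[OF assms(1)] place_in_T[OF assms(2)]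
  show ?thesis
  proof (cases s)
    case False
    show ?thesis by (rule near_common_arc[OF T, of "copy_a p" "copy_a q"]) (use assms(3,4) in \<open>auto simp: \<tau> False\<close>)
  next
    case True
    show ?thesis by (rule near_common_arc[OF T, of "copy_b q" "copy_b p"]) (use assms(3,4) in \<open>auto simp: \<tau> True\<close>)
  qed
qed

text \<open>
  The layer number counts the steps to the six central triangles: passing from \<open>a + b\<close> to \<open>a + b + 1\<close>
  takes one step into a \<open>True\<close> triangle and another one out of it.
\<close>
definition layer :: "bool \<Rightarrow> nat \<Rightarrow> (glued_vertex \<times> glued_vertex \<times> glued_vertex) set" where
  "layer s d = {place s (sector_triangle k a b u) |k a b u.
     0 \<le> a \<and> 0 \<le> b \<and> a + b + of_bool u < int r \<and> int d = 2 * (a + b) + of_bool u}"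

lemma layerI: "0 \<le> a \<Longrightarrow> 0 \<le> b \<Longrightarrow> a + b + of_bool u < int r \<Longrightarrow> int d = 2 * (a + b) + of_bool u \<Longrightarrow>
    place s (sector_triangle k a b u) \<in> layer s d"
  unfolding layer_def by blast

lemma near_sector_triangles:
  assumes "0 \<le> a" "0 \<le> b" "a + b + 1 < int r"
  shows "near 1 (place s (sector_triangle k a b False)) (place s (sector_triangle k a b True))"
    "near 1 (place s (sector_triangle k a b True)) (place s (sector_triangle k (a + 1) b False))"
    "near 1 (place s (sector_triangle k a b True)) (place s (sector_triangle k a (b + 1) False))"
  using assms
  by (intro near_place[where p = "pt k a (b + 1)" and q = "pt k (a + 1) b"]
            near_place[where p = "pt k (a + 1) (b + 1)" and q = "pt k (a + 1) b"]
            near_place[where p = "pt k a (b + 1)" and q = "pt k (a + 1) (b + 1)"];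
      simp add: sector_triangle_ccw del: sector_triangle.simps; simp add: add.commute)+

text \<open>
  The six central triangles form a cycle of length 6, whose diameter is 3.
\<close>
lemma near_core:
  assumes "\<tau> \<in> layer s 0" "\<sigma> \<in> layer s 0"
  shows "near 3 \<tau> \<sigma>"
proof -
  define c where "c k = place s (sector_triangle k 0 0 False)" for k
  have step: "near 1 (c k) (c (k + 1))" for k
    unfolding c_def using r_pos
    by (intro near_place[where p = "(0, 0)" and q = "pt k 0 1"])
       (simp_all only: sector_triangle_ccw, simp_all add: pt_next_sector)
  have chain: "near n (c k) (c (k + int n))" for n k
  proof (induct n)
    case 0
    then show ?case using r_pos by (auto simp: c_def sector_triangle_ccw simp del: sector_triangle.simps intro!: near_refl place_in_T)
  next
    case (Suc n)
    from near_trans[OF Suc step] show ?case by (simp add: algebra_simps)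
  qed
  have cong: "c k = c l" if "k mod 6 = l mod 6" for k l
    using that by (simp add: c_def pt_cong[of k l])
  (* Layer 0 forces a = b = 0 and the first kind of triangle. *)
  have "\<exists>k. \<tau> = c k" if "\<tau> \<in> layer s 0" for \<tau>
  proof -
    from that obtain k a b u where \<tau>: "\<tau> = place s (sector_triangle k a b u)" "0 \<le> a" "0 \<le> b" "0 = 2 * (a + b) + of_bool u"
      unfolding layer_def by auto
    then have "a = 0" "b = 0" "\<not> u" by (cases u; simp)+
    with \<tau> show ?thesis by (auto simp: c_def)
  qed
  with assms obtain k l where kl: "\<tau> = c k" "\<sigma> = c l" by blast
  (* From k to l it is m steps forwards and 6 - m steps backwards. *)
  define m where "m = nat ((l - k) mod 6)"
  have m: "int m = (l - k) mod 6" by (simp add: m_def)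
  then have "m < 6" by (metis of_nat_less_iff of_nat_numeral pos_mod_bound zero_less_numeral)
  have "(k + int m) mod 6 = l mod 6" unfolding m by (simp add: mod_simps)
  then have 1: "c (k + int m) = c l" by (rule cong)
  have "(l + int (6 - m)) mod 6 = k mod 6"
  proof -
    have "l + int (6 - m) = l - (l - k) mod 6 + 6" using m \<open>m < 6\<close> by (simp add: of_nat_diff)
    also have "\<dots> mod 6 = k mod 6" by (simp add: mod_simps)
    finally show ?thesis .
  qed
  then have 2: "c (l + int (6 - m)) = c k" by (rule cong)
  show ?thesis
  proof (cases "m \<le> 3")
    case True
    with chain[of m k] 1 kl show ?thesis using near_mono by metis
  next
    case False
    then have "6 - m \<le> 3" by simp
    with chain[of "6 - m" l] 2 kl show ?thesis using near_mono near_sym by metis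
  qed
qed

text \<open>
  A triangle of the last layer has the side from \<open>outer r i\<close> to \<open>outer r (i + 1)\<close> for some \<open>i\<close>.  The
  side with both indices shifted by \<open>t\<close>, forwards or backwards, belongs to the last layer of the other hexagon.
\<close>
lemma near_seam:
  assumes "\<tau> \<in> layer s (2 * r - 2)"
  shows "\<exists>\<sigma>\<in>layer (\<not> s) (2 * r - 2). near 1 \<tau> \<sigma>"
proof -
  obtain k a b u where \<tau>: "\<tau> = place s (sector_triangle k a b u)" "0 \<le> a" "0 \<le> b"
      "a + b + of_bool u < int r" "int (2 * r - 2) = 2 * (a + b) + of_bool u"
    using assms unfolding layer_def by blast
  have u: "\<not> u" "a + b = int r - 1" using \<tau>(4,5) r_ge by (cases u; simp)+
  have corner: "pt k (a + 1) b = outer r (k * int r + b)" "pt k a (b + 1) = outer r (k * int r + b + 1)"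
    if "0 \<le> a" "0 \<le> b" "a + b = int r - 1" for k a b
  proof -
    from that have "a = int r - 1 - b" by simp
    with that show "pt k (a + 1) b = outer r (k * int r + b)" "pt k a (b + 1) = outer r (k * int r + b + 1)"
      using outer_pt[OF r_pos, of b k] outer_pt[OF r_pos, of "b + 1" k] by (simp_all add: add.assoc)
  qed
  define i where "i = k * int r + b"
  define j where "j = (if s then i - int t else i + int t)"
  obtain l d where ld: "j = l * int r + d" "0 \<le> d" "d < int r" using r_pos by (rule outer_sector)
  (* The triangle of the last layer whose outer side starts at index j of the other hexagon. *)
  define c where "c = int r - 1 - d"
  have cd: "0 \<le> c" "0 \<le> d" "c + d = int r - 1" using ld by (simp_all add: c_def)
  define \<sigma> where "\<sigma> = place (\<not> s) (sector_triangle l c d False)"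
  have \<sigma>: "\<sigma> \<in> layer (\<not> s) (2 * r - 2)" unfolding \<sigma>_def using cd r_ge by (intro layerI) auto
  have \<tau>T: "\<tau> \<in> T" unfolding \<tau>(1) using \<tau> by (intro place_in_T) (simp add: sector_triangle_ccw)
  have \<sigma>T: "\<sigma> \<in> T" unfolding \<sigma>_def using cd by (intro place_in_T) (simp add: sector_triangle_ccw del: sector_triangle.simps)
  have P: "pt k (a + 1) b = outer r i" "pt k a (b + 1) = outer r (i + 1)"
    using corner[OF \<tau>(2,3) u(2)] by (simp_all add: i_def)
  have Q: "pt l (c + 1) d = outer r j" "pt l c (d + 1) = outer r (j + 1)"
    using corner[OF cd] by (simp_all add: ld)
  have "near 1 \<tau> \<sigma>"
  proof (cases s)
    case False
    then have seam: "copy_b (outer r j) = copy_a (outer r i)" "copy_b (outer r (j + 1)) = copy_a (outer r (i + 1))"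
      by (simp_all add: copy_a_outer j_def algebra_simps)
    show ?thesis
      by (rule near_common_arc[OF \<tau>T \<sigma>T, of "copy_a (outer r (i + 1))" "copy_a (outer r i)"])
         (use u in \<open>simp_all add: \<tau>(1) \<sigma>_def False P Q seam\<close>)
  next
    case True
    then have seam: "copy_a (outer r j) = copy_b (outer r i)" "copy_a (outer r (j + 1)) = copy_b (outer r (i + 1))"
      by (simp_all add: copy_a_outer j_def algebra_simps)
    show ?thesis
      by (rule near_common_arc[OF \<tau>T \<sigma>T, of "copy_b (outer r i)" "copy_b (outer r (i + 1))"])
         (use u in \<open>simp_all add: \<tau>(1) \<sigma>_def True P Q seam\<close>)
  qed
  with \<sigma> show ?thesis by blast
qed

lemma near_inwards:
  assumes "\<tau> \<in> layer s (Suc d)"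
  shows "\<exists>\<sigma>\<in>layer s d. near 1 \<tau> \<sigma>"
proof -
  obtain k a b u where \<tau>: "\<tau> = place s (sector_triangle k a b u)" "0 \<le> a" "0 \<le> b"
      "a + b + of_bool u < int r" "int (Suc d) = 2 * (a + b) + of_bool u"
    using assms unfolding layer_def by blast
  show ?thesis
  proof (cases u)
    case True
    show ?thesis
    proof (rule bexI)
      show "near 1 \<tau> (place s (sector_triangle k a b False))"
        unfolding \<tau>(1) using \<tau> True near_sector_triangles(1) near_sym by simp
      show "place s (sector_triangle k a b False) \<in> layer s d" using \<tau> True by (intro layerI) auto
    qed
  next
    case False
    show ?thesis
    proof (cases "0 < a")
      case True
      show ?thesis
      proof (rule bexI)
        show "near 1 \<tau> (place s (sector_triangle k (a - 1) b True))"
          unfolding \<tau>(1) using \<tau> True False near_sector_triangles(2)[of "a - 1" b s k] near_sym by simp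
        show "place s (sector_triangle k (a - 1) b True) \<in> layer s d" using \<tau> True False by (intro layerI) auto
      qed
    next
      case a: False
      with \<tau> False have b: "0 < b" by auto
      show ?thesis
      proof (rule bexI)
        show "near 1 \<tau> (place s (sector_triangle k a (b - 1) True))"
          unfolding \<tau>(1) using \<tau> b False near_sector_triangles(3)[of a "b - 1" s k] near_sym by simp
        show "place s (sector_triangle k a (b - 1) True) \<in> layer s d" using \<tau> b False by (intro layerI) auto
      qed
    qed
  qed
qed

lemma near_outwards:
  assumes "\<tau> \<in> layer s d" "d < 2 * r - 2"
  shows "\<exists>\<sigma>\<in>layer s (Suc d). near 1 \<tau> \<sigma>"
proof -
  obtain k a b u where \<tau>: "\<tau> = place s (sector_triangle k a b u)" "0 \<le> a" "0 \<le> b"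
      "a + b + of_bool u < int r" "int d = 2 * (a + b) + of_bool u"
    using assms unfolding layer_def by blast
  show ?thesis
  proof (cases u)
    case True
    show ?thesis
    proof (rule bexI)
      show "near 1 \<tau> (place s (sector_triangle k (a + 1) b False))"
        unfolding \<tau>(1) using \<tau> True near_sector_triangles(2) by simp
      show "place s (sector_triangle k (a + 1) b False) \<in> layer s (Suc d)" using \<tau> True by (intro layerI) auto
    qed
  next
    case False
    have lt: "a + b + 1 < int r" using \<tau>(5) False assms(2) r_ge by simp
    show ?thesis
    proof (rule bexI)
      show "near 1 \<tau> (place s (sector_triangle k a b True))"
        unfolding \<tau>(1) using \<tau> False lt near_sector_triangles(1) by simp
      show "place s (sector_triangle k a b True) \<in> layer s (Suc d)" using \<tau> False lt by (intro layerI) auto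
    qed
  qed
qed

lemma layer_subset: "layer s d \<subseteq> T"
  by (auto simp: layer_def sector_triangle_ccw simp del: sector_triangle.simps intro!: place_in_T)

lemma triangle_in_layer:
  assumes "\<tau> \<in> T"
  obtains s d \<sigma> where "d \<le> 2 * r - 2" "\<sigma> \<in> layer s d" "rev_sides \<sigma> = rev_sides \<tau>"
proof -
  obtain s \<tau>' where \<tau>: "\<tau> = place s \<tau>'" "\<tau>' \<in> ccw_triangles r" using assms unfolding T_place by blast
  obtain x k where \<tau>': "\<tau>' = (x, x + dir k, x + dir (k + 1))" using \<tau>(2) unfolding ccw_triangles_def by blast
  define y z where "y = x + dir k" and "z = x + dir (k + 1)"
  obtain l a b u where ab: "0 \<le> a" "0 \<le> b" "sector_triangle l a b u \<in> {(x, y, z), (y, z, x), (z, x, y)}"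
    by (rule triangle_in_sector[OF y_def z_def])
  have "(x, y, z) \<in> ccw_triangles r" using \<tau>(2) \<tau>' by (simp add: y_def z_def)
  then have "{(x, y, z), (y, z, x), (z, x, y)} \<subseteq> ccw_triangles r" using ccw_rotate by blast
  with ab have "sector_triangle l a b u \<in> ccw_triangles r" by blast
  then have lt: "a + b + of_bool u < int r" using ab by (simp add: sector_triangle_ccw)
  have "place s (sector_triangle l a b u) \<in> layer s (nat (2 * (a + b) + of_bool u))"
    using ab lt by (intro layerI) auto
  moreover have "nat (2 * (a + b) + of_bool u) \<le> 2 * r - 2" using lt by (cases u) auto
  moreover have "rev_sides (place s (sector_triangle l a b u)) = rev_sides \<tau>"
  proof -
    have rot: "rev_sides (place s (x, y, z)) = rev_sides (place s (y, z, x))" for x y z by (cases s) auto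
    have "rev_sides (place s (sector_triangle l a b u)) = rev_sides (place s (x, y, z))"
      using ab(3) rot[of x y z] rot[of z x y] by (elim insertE emptyE; simp only:)
    then show ?thesis by (simp only: \<tau>(1) \<tau>' y_def z_def)
  qed
  ultimately show thesis using that by blast
qed

lemma near_any:
  assumes "\<tau> \<in> T" "\<tau>' \<in> T"
  shows "near (4 * r) \<tau> \<tau>'"
proof -
  obtain s d \<sigma> where \<sigma>: "d \<le> 2 * r - 2" "\<sigma> \<in> layer s d" "rev_sides \<sigma> = rev_sides \<tau>"
    using assms(1) by (rule triangle_in_layer)
  obtain s' d' \<sigma>' where \<sigma>': "d' \<le> 2 * r - 2" "\<sigma>' \<in> layer s' d'" "rev_sides \<sigma>' = rev_sides \<tau>'"
    using assms(2) by (rule triangle_in_layer)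
  have "near (2 * (2 * r - 2) + 4) \<sigma> \<sigma>'"
    by (rule near_two_caps[where D = layer, OF layer_subset near_inwards near_outwards near_seam near_core \<sigma>(2,1) \<sigma>'(2,1)])
  moreover have "2 * (2 * r - 2) + 4 = 4 * r" using r_ge by simp
  ultimately show ?thesis using near_cong[OF \<sigma>(3) \<sigma>'(3)] by simp
qed

lemma fullerene_D: "fullerene_graph (D_graph r t) (D_rotation r t)"
  unfolding D_graph_eq
proof (rule dual_fullerene)
  have "T \<noteq> {}" using card_T r_pos by auto
  with near_any show "Digraph_Component.connected dual" by (rule connectedI)
  show "6 * card V = card T + 12" by (simp add: card_V card_T)
qed

lemma card_D: "card (verts (D_graph r t)) = 12 * r\<^sup>2"
  using card_dual_verts by (simp add: D_graph_eq card_T)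

lemma diam_D: "diam (D_graph r t) \<le> ereal (4 * real r)"
  using diam_le[OF near_any] by (simp add: D_graph_eq)

end

theorem theorem1:
  fixes r t :: nat
  assumes "r \<ge> 2" and "1 \<le> t" and "t \<le> r - 1"
  shows "fullerene_graph (D_graph r t) (D_rotation r t) \<and>
         card (verts (D_graph r t)) = 12 * r ^ 2 \<and>
         diam (D_graph r t) \<le> ereal (4 * real r) \<and>
         diam (D_graph r t) \<le> ereal (sqrt (4 * real (card (verts (D_graph r t))) / 3)) \<and>
         (\<exists>(G :: ((glued_vertex \<times> glued_vertex) set, glued_vertex \<times> glued_vertex) pre_digraph) M.
            fullerene_graph G M \<and> card (verts G) = 12 * r ^ 2 \<and> diam G \<le> ereal (4 * real r))"
proof -
  interpret hexagon_gluing r t using assms by unfold_locales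
  have "4 * real (card (verts (D_graph r t))) / 3 = (4 * real r)\<^sup>2"
    by (simp add: card_D power2_eq_square)
  then have "sqrt (4 * real (card (verts (D_graph r t))) / 3) = 4 * real r"
    by (simp only: real_sqrt_abs)
  with fullerene_D card_D diam_D show ?thesis
    by (intro conjI exI[of _ "D_graph r t"] exI[of _ "D_rotation r t"]) simp_all
qed

end
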